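(* Let $(m(r),P(r))$, $0<r<r_+$, be any monotone-short solution of the Tolman-Oppenheimer-Volkoff-de Sitter equation, with associated $u(r)$ and density $\rho(r)$, and put $B:=\dfrac{Q_+}{r_+^2\kappa_+}$. Then, as $r\to r_+-0$ (i.e. for $r<r_+$ sufficiently close to $r_+$), $$u(r)=B(r_+-r)\Big(1+[\,r_+-r,\ (r_+-r)^{\frac{\gamma}{\gamma-1}}]_1\Big),$$ and therefore $$\rho(r)=\Big(\frac{(\gamma-1)B}{\gamma A}\Big)^{\frac1{\gamma-1}}(r_+-r)^{\frac1{\gamma-1}}\Big(1+[\,r_+-r,\ (r_+-r)^{\frac{\gamma}{\gamma-1}}]_1\Big).$$ Here each occurrence of $[X_1,X_2]_1$ stands for some (possibly different) convergent double power series of the form $\sum_{k_1+k_2\ge1}a_{k_1k_2}X_1^{k_1}X_2^{k_2}$.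
   Context: Constants: $c>0$, $G>0$, $\Lambda>0$. Standing assumption on the pressure: $P$ is a given function of the density $\rho>0$ with $P>0$ and $0<dP/d\rho<c^2$ for $\rho>0$, and $P\to0$ as $\rho\to+0$; moreover $P=A\rho^{\gamma}\Omega(A\rho^{\gamma-1}/c^2)$ with positive constants $A,\gamma$, $1<\gamma<2$, and $\Omega$ real analytic on a neighborhood of $[0,+\infty)$ with $\Omega(0)=1$. Since $P$ is strictly increasing in $\rho$, $\rho$ is regarded as a function of $P$. Notation: $\kappa(r,m):=1-\frac{2Gm}{c^2r}-\frac{\Lambda}{3}r^2$ and $Q(r,m,P):=G\big(m+\frac{4\pi r^3}{c^2}P\big)-\frac{c^2\Lambda}{3}r^3$. The Tolman-Oppenheimer-Volkoff-de Sitter equation is the system $$\frac{dm}{dr}=4\pi r^2\rho,\qquad \frac{dP}{dr}=-(\rho+P/c^2)\frac{Q(r,m,P)}{r^2\kappa(r,m)}$$ considered on the domain $\mathcal D=\{(r,m,P): 0<r,\ |m|<+\infty,\ 0<\rho,\ 0<\kappa(r,m)\}$. Monotone-short: a solution $(m(r),P(r))$, $0<r<r_+$, is monotone-short if $r_+<\infty$, $dP/dr<0$ for $0<r<r_+$, $P\to0$ as $r\to r_+$, and $\kappa_+>0$, $Q_+>0$, where, with $m_+:=\lim_{r\to r_+-0}m(r)$, $$\kappa_+:=\lim_{r\to r_+-0}\kappa(r,m(r))=1-\frac{2Gm_+}{c^2r_+}-\frac{\Lambda}{3}r_+^2,\qquad Q_+:=\lim_{r\to r_+-0}Q(r,m(r),P(r))=Gm_+-\frac{c^2\Lambda}{3}r_+^3.$$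 The variable $u$: $u:=\int_0^{\rho}\frac{dP}{\rho+P/c^2}=\int_0^{\rho}\frac{P'(\rho')\,d\rho'}{\rho'+P(\rho')/c^2}$, and $u(r)$ is its value at the density $\rho(r)$ of the solution. *)

theory Defs
  imports "HOL-Analysis.Analysis"
begin

text \<open>Throughout, \<^term>\<open>eos :: real \<Rightarrow> real\<close> is the equation of state, i.e. the pressure as a
  function of the density. Only its values at positive densities are relevant.\<close>

text \<open>Real analyticity on an open neighbourhood of \<open>S\<close>: at each point the function agrees
  locally with a power series of positive radius of convergence.\<close>

definition real_analytic_near :: "(real \<Rightarrow> real) \<Rightarrow> real set \<Rightarrow> bool" where
  "real_analytic_near f S \<longleftrightarrow>
     (\<exists>U. open U \<and> S \<subseteq> U \<and> (\<forall>x\<in>U. \<exists>F. (\<lambda>h. f (x + h)) has_fps_expansion F))"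

definition density_of_pressure :: "(real \<Rightarrow> real) \<Rightarrow> real \<Rightarrow> real" where
  "density_of_pressure eos = the_inv_into {0<..} eos"

definition kappa :: "real \<Rightarrow> real \<Rightarrow> real \<Rightarrow> real \<Rightarrow> real \<Rightarrow> real" where
  "kappa c G \<Lambda> r m = 1 - 2 * G * m / (c\<^sup>2 * r) - \<Lambda> / 3 * r\<^sup>2"

definition Qfun :: "real \<Rightarrow> real \<Rightarrow> real \<Rightarrow> real \<Rightarrow> real \<Rightarrow> real \<Rightarrow> real" where
  "Qfun c G \<Lambda> r m P = G * (m + 4 * pi * r ^ 3 / c\<^sup>2 * P) - c\<^sup>2 * \<Lambda> / 3 * r ^ 3"

text \<open>The condition \<open>0 < \<rho>\<close> on a pressure value \<open>P\<close> says that \<open>P\<close> is attained at a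
  positive density; the equation of state need not be unbounded.\<close>

definition tov_domain ::
    "real \<Rightarrow> real \<Rightarrow> real \<Rightarrow> (real \<Rightarrow> real) \<Rightarrow> (real \<times> real \<times> real) set" where
  "tov_domain c G \<Lambda> eos =
     {(r, m, P). 0 < r \<and> P \<in> eos ` {0<..} \<and> 0 < kappa c G \<Lambda> r m}"

definition tov_solution ::
    "real \<Rightarrow> real \<Rightarrow> real \<Rightarrow> (real \<Rightarrow> real) \<Rightarrow> real \<Rightarrow> (real \<Rightarrow> real) \<Rightarrow> (real \<Rightarrow> real) \<Rightarrow> bool" where
  "tov_solution c G \<Lambda> eos rp m P \<longleftrightarrow>
     (\<forall>r\<in>{0<..<rp}.
        (r, m r, P r) \<in> tov_domain c G \<Lambda> eos \<and>
        (m has_real_derivative 4 * pi * r\<^sup>2 * density_of_pressure eos (P r)) (at r) \<and>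
        (P has_real_derivative
           - (density_of_pressure eos (P r) + P r / c\<^sup>2)
             * (Qfun c G \<Lambda> r (m r) (P r) / (r\<^sup>2 * kappa c G \<Lambda> r (m r)))) (at r))"

text \<open>For a solution whose pressure tends to \<open>0\<close> at \<open>rp\<close>, both limits below exist: \<open>m\<close> is
  increasing, and it is bounded above near \<open>rp\<close> because \<open>0 < \<kappa>\<close>.\<close>

definition kappa_plus :: "real \<Rightarrow> real \<Rightarrow> real \<Rightarrow> real \<Rightarrow> (real \<Rightarrow> real) \<Rightarrow> real" where
  "kappa_plus c G \<Lambda> rp m = Lim (at_left rp) (\<lambda>r. kappa c G \<Lambda> r (m r))"

definition Q_plus ::
    "real \<Rightarrow> real \<Rightarrow> real \<Rightarrow> real \<Rightarrow> (real \<Rightarrow> real) \<Rightarrow> (real \<Rightarrow> real) \<Rightarrow> real" where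
  "Q_plus c G \<Lambda> rp m P = Lim (at_left rp) (\<lambda>r. Qfun c G \<Lambda> r (m r) (P r))"

text \<open>Finiteness of the radius is expressed by \<open>rp\<close> being a real number.\<close>

definition monotone_short ::
    "real \<Rightarrow> real \<Rightarrow> real \<Rightarrow> (real \<Rightarrow> real) \<Rightarrow> real \<Rightarrow> (real \<Rightarrow> real) \<Rightarrow> (real \<Rightarrow> real) \<Rightarrow> bool" where
  "monotone_short c G \<Lambda> eos rp m P \<longleftrightarrow>
     0 < rp \<and> tov_solution c G \<Lambda> eos rp m P \<and>
     (\<forall>r\<in>{0<..<rp}. deriv P r < 0) \<and>
     (P \<longlongrightarrow> 0) (at_left rp) \<and>
     0 < kappa_plus c G \<Lambda> rp m \<and> 0 < Q_plus c G \<Lambda> rp m P"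

text \<open>The integrand is singular at \<open>0\<close> for \<open>\<gamma> < 2\<close>; the gauge integral covers this, and the
  value of the integrand at the single point \<open>0\<close> is immaterial.\<close>

definition u_of_density :: "real \<Rightarrow> (real \<Rightarrow> real) \<Rightarrow> real \<Rightarrow> real" where
  "u_of_density c eos \<rho> = integral {0..\<rho>} (\<lambda>s. deriv eos s / (s + eos s / c\<^sup>2))"

text \<open>Double power series without constant term; the coefficient \<open>a 0 0\<close> is never used.
  Convergence means (unconditional, hence absolute) summability on a neighbourhood of the origin.\<close>

definition dps_index :: "(nat \<times> nat) set" where
  "dps_index = {(i, j). i + j \<ge> 1}"

definition dps_convergent :: "(nat \<Rightarrow> nat \<Rightarrow> real) \<Rightarrow> bool" where
  "dps_convergent a \<longleftrightarrow>
     (\<exists>\<delta>>0. \<forall>x y. \<bar>x\<bar> < \<delta> \<longrightarrow> \<bar>y\<bar> < \<delta> \<longrightarrow>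
        (\<lambda>(i, j). a i j * x ^ i * y ^ j) summable_on dps_index)"

definition dps_eval :: "(nat \<Rightarrow> nat \<Rightarrow> real) \<Rightarrow> real \<Rightarrow> real \<Rightarrow> real" where
  "dps_eval a x y = (\<Sum>\<^sub>\<infinity>(i, j)\<in>dps_index. a i j * x ^ i * y ^ j)"

end

theory Submission
  imports Defs "HOL-Complex_Analysis.Complex_Analysis" "HOL-Real_Asymp.Real_Asymp"
begin

text \<open>With \<open>\<eta> = A \<rho>^(\<gamma> - 1) / c^2\<close> both \<open>u / \<eta>\<close> and \<open>K = 1 / (du / d\<eta>)\<close> are analytic functions
  of \<open>\<eta>\<close>, while \<open>\<rho>\<close> and \<open>P\<close> are constant multiples of \<open>\<eta>^\<nu>\<close> and \<open>\<eta>^(\<nu> + 1) \<Omega>(\<eta>)\<close>, where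
  \<open>\<nu> = 1 / (\<gamma> - 1)\<close>. Put \<open>x = rp - r\<close>, \<open>y = x^(\<nu> + 1)\<close>, \<open>\<eta> = \<beta> x w\<close> and \<open>m = mp - v\<close>, where \<open>mp\<close> is
  the limit of \<open>m\<close>. The equation becomes the fixed point problem
  \<open>w(x, y) = \<integral>\<^sub>0\<^sup>1 F(t x, t^(\<nu> + 1) y, w, v) dt\<close>, \<open>v(x, y) = y \<integral>\<^sub>0\<^sup>1 t^\<nu> E(t x, w) dt\<close>
  with analytic \<open>F\<close> and \<open>E\<close>, in which \<open>x\<close> and \<open>y\<close> may be treated as independent complex variables.
  Since \<open>F(0, 0, w, v)\<close> does not depend on \<open>w\<close>, the right-hand side is a contraction for functions on
  a small bidisc, and also for functions on the curve \<open>y = x^(\<nu> + 1)\<close>, which is invariant under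
  \<open>(x, y) \<mapsto> (t x, t^(\<nu> + 1) y)\<close>. The Picard iterates therefore converge to a holomorphic function on
  the bidisc and to the given solution on the curve.\<close>

section \<open>Separately holomorphic functions of two variables\<close>

text \<open>The pressure and the mass deficit are the only terms of the equation for \<eta> that are
  not analytic in x and \<eta>: the factor (\<rho> + P/c^2) / (dP/d\<rho>) times d\<eta>/d\<rho> is
  K(\<eta>), P is of order \<eta>^(\<nu> + 1), and the deficit integrates \<rho>, which adds one
  power of x to x^\<nu>. So x^\<nu> never enters alone, and y, whose exponent is \<nu> + 1 =
  \<gamma> / (\<gamma> - 1), absorbs all that is irregular when \<nu> is not an integer. The
  constant \<beta> = K(0) B is the slope of \<eta> at the boundary; it normalises w to 1 at the
  origin, away from the branch cut of w^\<nu>. The obstacle is identification: nothing says in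
  advance that the solution is the restriction of a function of two variables, and differentiability
  at the boundary is not given. The integral equation needs only continuity up to x = 0, and its
  unique solvability on the curve forces the given solution to be that restriction. At the end u = B
  x K(0) w U(\<eta>), where u = \<eta> U(\<eta>) and K(0) U(0) = 1, and \<rho> is a constant times
  x^\<nu> w^\<nu>.\<close>

text \<open>Joint continuity is part of the notion so that Taylor coefficients in one variable,
  written as Cauchy integrals, are holomorphic in the other without an appeal to Hartogs'
  theorem.\<close>

definition bihol :: "real \<Rightarrow> (complex \<Rightarrow> complex \<Rightarrow> complex) \<Rightarrow> bool" where
  "bihol d f \<longleftrightarrow> continuous_on (ball 0 d \<times> ball 0 d) (\<lambda>(x, y). f x y) \<and>
     (\<forall>y\<in>ball 0 d. (\<lambda>x. f x y) holomorphic_on ball 0 d) \<and>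
     (\<forall>x\<in>ball 0 d. (\<lambda>y. f x y) holomorphic_on ball 0 d)"

lemma continuous_on_contour_integral_param:
  assumes cont: "continuous_on (S \<times> path_image g) (\<lambda>(x, z). f x z)" and "path g"
    and vd: "continuous_on {0..1} (\<lambda>t. vector_derivative g (at t))"
  shows "continuous_on S (\<lambda>x. contour_integral g (f x))"
proof -
  have "continuous_on (S \<times> cbox 0 1) (\<lambda>(x, t). f x (g t) * vector_derivative g (at t))"
  proof -
    have "continuous_on (S \<times> {0..1}) (\<lambda>p. (\<lambda>(x, z). f x z) (fst p, g (snd p)))"
      by (rule continuous_on_compose2 [OF cont])
         (use \<open>path g\<close> in \<open>auto simp: path_def path_image_def
            intro!: continuous_intros continuous_on_compose2 [of "{0..1}" g]\<close>)
    moreover have "continuous_on (S \<times> {0..1}) (\<lambda>p. vector_derivative g (at (snd p)))"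
      by (rule continuous_on_compose2 [OF vd]) (auto intro!: continuous_intros)
    ultimately show ?thesis
      by (auto simp: case_prod_unfold intro!: continuous_intros)
  qed
  from integral_continuous_on_param [OF this] show ?thesis
    by (simp add: contour_integral_integral)
qed

text \<open>Morera's theorem applies: Fubini moves the integral over a triangle inside the integral
  along \<open>g\<close>, where Cauchy's theorem makes it vanish for each fixed
  \<open>z\<close>.\<close>

lemma holomorphic_on_contour_integral_param:
  assumes "open S" "valid_path g"
    and vd: "continuous_on {0..1} (\<lambda>t. vector_derivative g (at t))"
    and cont: "continuous_on (S \<times> path_image g) (\<lambda>(x, z). f x z)"
    and hol: "\<And>z. z \<in> path_image g \<Longrightarrow> (\<lambda>x. f x z) holomorphic_on S"
  shows "(\<lambda>x. contour_integral g (f x)) holomorphic_on S"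
proof -
  have swap: "contour_integral (linepath a b) (\<lambda>x. contour_integral g (f x)) =
       contour_integral g (\<lambda>z. contour_integral (linepath a b) (\<lambda>x. f x z))"
    and cs: "continuous_on (path_image g) (\<lambda>z. contour_integral (linepath a b) (\<lambda>x. f x z))"
    if "closed_segment a b \<subseteq> S" for a b
  proof -
    show "contour_integral (linepath a b) (\<lambda>x. contour_integral g (f x)) =
       contour_integral g (\<lambda>z. contour_integral (linepath a b) (\<lambda>x. f x z))"
      by (rule contour_integral_swap)
         (use assms that in \<open>auto intro!: continuous_intros continuous_on_subset [OF cont]\<close>)
    have "continuous_on (path_image g \<times> path_image (linepath a b)) (\<lambda>p. (\<lambda>(x, z). f x z) (snd p, fst p))"
      by (rule continuous_on_compose2 [OF cont]) (use that in \<open>auto intro!: continuous_intros\<close>)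
    then have "continuous_on (path_image g \<times> path_image (linepath a b)) (\<lambda>(z, x). f x z)"
      by (simp add: case_prod_unfold)
    then show "continuous_on (path_image g) (\<lambda>z. contour_integral (linepath a b) (\<lambda>x. f x z))"
      by (rule continuous_on_contour_integral_param) (auto intro!: continuous_intros)
  qed
  have int: "h contour_integrable_on g" if "continuous_on (path_image g) h" for h
    unfolding contour_integrable_on
  proof (rule integrable_continuous_real)
    have "continuous_on {0..1} (\<lambda>t. h (g t))"
      using that \<open>valid_path g\<close> valid_path_imp_path
      by (intro continuous_on_compose2 [OF that]) (auto simp: path_def path_image_def)
    then show "continuous_on {0..1} (\<lambda>t. h (g t) * vector_derivative g (at t))"
      by (intro continuous_intros vd)
  qed
  have "(\<lambda>x. contour_integral g (f x)) analytic_on S"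
  proof (rule Morera_triangle [OF _ \<open>open S\<close>])
    show "continuous_on S (\<lambda>x. contour_integral g (f x))"
      using assms valid_path_imp_path by (intro continuous_on_contour_integral_param) auto
    show "convex hull {a, b, c} \<subseteq> S \<longrightarrow>
      contour_integral (linepath a b) (\<lambda>x. contour_integral g (f x)) +
      contour_integral (linepath b c) (\<lambda>x. contour_integral g (f x)) +
      contour_integral (linepath c a) (\<lambda>x. contour_integral g (f x)) = 0" for a b c
    proof
      assume abc: "convex hull {a, b, c} \<subseteq> S"
      then have seg: "closed_segment a b \<subseteq> S" "closed_segment b c \<subseteq> S" "closed_segment c a \<subseteq> S"
        by (auto simp: segment_convex_hull intro!: order.trans [OF hull_mono abc])
      have zero: "contour_integral (linepath a b) (\<lambda>x. f x z) +
          contour_integral (linepath b c) (\<lambda>x. f x z) +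
          contour_integral (linepath c a) (\<lambda>x. f x z) = 0" if "z \<in> path_image g" for z
      proof -
        note h = hol [OF that]
        have i: "(\<lambda>x. f x z) contour_integrable_on linepath p q" if "closed_segment p q \<subseteq> S" for p q
          using holomorphic_on_imp_continuous_on [OF h] continuous_on_subset that
          by (blast intro: contour_integrable_continuous_linepath)
        have "((\<lambda>x. f x z) has_contour_integral 0) (linepath a b +++ linepath b c +++ linepath c a)"
          by (rule Cauchy_theorem_triangle) (use holomorphic_on_subset [OF h abc] in auto)
        then have "contour_integral (linepath a b +++ linepath b c +++ linepath c a) (\<lambda>x. f x z) = 0"
          by (rule contour_integral_unique)
        then show ?thesis
          using i seg by (simp add: add.assoc)
      qed
      have "contour_integral g (\<lambda>z. contour_integral (linepath a b) (\<lambda>x. f x z)) +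
          contour_integral g (\<lambda>z. contour_integral (linepath b c) (\<lambda>x. f x z)) +
          contour_integral g (\<lambda>z. contour_integral (linepath c a) (\<lambda>x. f x z)) =
          contour_integral g (\<lambda>z. contour_integral (linepath a b) (\<lambda>x. f x z) +
          contour_integral (linepath b c) (\<lambda>x. f x z) +
          contour_integral (linepath c a) (\<lambda>x. f x z))"
        using cs seg int by (simp add: contour_integral_add contour_integrable_add)
      also have "\<dots> = contour_integral g (\<lambda>z. 0)"
        using zero by (intro contour_integral_cong) auto
      finally show "contour_integral (linepath a b) (\<lambda>x. contour_integral g (f x)) +
          contour_integral (linepath b c) (\<lambda>x. contour_integral g (f x)) +
          contour_integral (linepath c a) (\<lambda>x. contour_integral g (f x)) = 0"
        using seg by (simp add: swap)
    qed
  qed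
  then show ?thesis
    by (simp add: analytic_imp_holomorphic)
qed

text \<open>The function is expanded in \<open>y\<close> for fixed \<open>x\<close>; the
  coefficients \<open>co j\<close> are Cauchy integrals, hence holomorphic in \<open>x\<close>, and
  are expanded in turn. Cauchy's inequality, used once in each variable on the radius
  \<open>r\<close>, bounds \<open>a i j\<close> by M / r^(i + j).\<close>

lemma bihol_power_series:
  assumes f: "bihol d f" and "0 < d"
  obtains a :: "nat \<Rightarrow> nat \<Rightarrow> complex" and e where "0 < e"
    and "\<And>x y. norm x < e \<Longrightarrow> norm y < e \<Longrightarrow>
        ((\<lambda>(i, j). a i j * x ^ i * y ^ j) has_sum f x y) UNIV"
proof -
  define r where "r = d / 2"
  have r: "0 < r" "r < d" using \<open>0 < d\<close> by (auto simp: r_def)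
  have cont: "continuous_on (ball 0 d \<times> ball 0 d) (\<lambda>(x, y). f x y)"
    and hx: "\<And>y. norm y < d \<Longrightarrow> (\<lambda>x. f x y) holomorphic_on ball 0 d"
    and hy: "\<And>x. norm x < d \<Longrightarrow> f x holomorphic_on ball 0 d"
    using f by (auto simp: bihol_def)
  have sub: "cball (0::complex) r \<subseteq> ball 0 d" using r by auto
  have "compact ((\<lambda>(x, y). f x y) ` (cball 0 r \<times> cball 0 r))"
    by (intro compact_continuous_image compact_Times compact_cball continuous_on_subset [OF cont])
       (use sub in auto)
  then have "bounded ((\<lambda>(x, y). f x y) ` (cball 0 r \<times> cball 0 r))"
    by (rule compact_imp_bounded)
  then obtain M where "\<forall>z\<in>(\<lambda>(x, y). f x y) ` (cball 0 r \<times> cball 0 r). norm z \<le> M"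
    unfolding bounded_iff by blast
  then have M: "norm (f x y) \<le> M" if "norm x \<le> r" "norm y \<le> r" for x y
    using that by auto
  have "0 \<le> M" using order.trans [OF norm_ge_zero M [of 0 0]] r by auto
  define co where "co j x = (deriv ^^ j) (f x) 0 / fact j" for j x
  have co_eq: "co j x = contour_integral (circlepath 0 r) (\<lambda>z. f x z / z ^ Suc j) / (2 * pi * \<i>)"
    if "norm x < d" for j x
  proof -
    have h: "f x holomorphic_on cball 0 r"
      using holomorphic_on_subset [OF hy [OF that] sub] .
    have "contour_integral (circlepath 0 r) (\<lambda>z. f x z / (z - 0) ^ Suc j) =
        2 * pi * \<i> * (deriv ^^ j) (f x) 0 / fact j"
      by (rule Cauchy_contour_integral_circlepath)
         (use h r in \<open>auto intro: holomorphic_on_imp_continuous_on holomorphic_on_subset\<close>)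
    then show ?thesis
      by (simp add: co_def)
  qed
  have co_hol: "co j holomorphic_on ball 0 d" for j
  proof -
    have "(\<lambda>x. contour_integral (circlepath 0 r) (\<lambda>z. f x z / z ^ Suc j)) holomorphic_on ball 0 d"
    proof (rule holomorphic_on_contour_integral_param)
      show "continuous_on (ball 0 d \<times> path_image (circlepath 0 r)) (\<lambda>(x, z). f x z / z ^ Suc j)"
        unfolding case_prod_unfold using r
        by (intro continuous_intros continuous_on_subset [OF cont [unfolded case_prod_unfold]])
           (auto simp: path_image_circlepath)
      show "(\<lambda>x. f x z / z ^ Suc j) holomorphic_on ball 0 d" if "z \<in> path_image (circlepath 0 r)" for z
        using that r by (intro holomorphic_intros hx) (auto simp: path_image_circlepath)
      show "continuous_on {0..1} (\<lambda>t. vector_derivative (circlepath 0 r) (at t))"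
        by (auto simp: vector_derivative_circlepath intro!: continuous_intros)
    qed auto
    then have "(\<lambda>x. contour_integral (circlepath 0 r) (\<lambda>z. f x z / z ^ Suc j) / (2 * pi * \<i>)) holomorphic_on ball 0 d"
      by (intro holomorphic_intros) auto
    then show ?thesis
      by (rule holomorphic_transform) (use co_eq in auto)
  qed
  have co_bound: "norm (co j x) \<le> M / r ^ j" if "norm x \<le> r" for j x
  proof -
    have h: "f x holomorphic_on ball 0 d" using hy that r by auto
    have "norm ((deriv ^^ j) (f x) 0) \<le> fact j * M / r ^ j"
      by (rule Cauchy_inequality)
         (use h sub r M that in \<open>auto intro!: holomorphic_on_imp_continuous_on elim: holomorphic_on_subset\<close>)
    then show ?thesis
      by (simp add: co_def norm_divide field_simps)
  qed
  define a where "a i j = (deriv ^^ i) (co j) 0 / fact i" for i j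
  have a_bound: "norm (a i j) \<le> M / r ^ j / r ^ i" for i j
  proof -
    have "norm ((deriv ^^ i) (co j) 0) \<le> fact i * (M / r ^ j) / r ^ i"
      by (rule Cauchy_inequality)
         (use co_hol [of j] sub r co_bound in \<open>auto intro!: holomorphic_on_imp_continuous_on elim: holomorphic_on_subset\<close>)
    then show ?thesis
      by (simp add: a_def norm_divide field_simps)
  qed
  have "((\<lambda>(i, j). a i j * x ^ i * y ^ j) has_sum f x y) UNIV"
    if x: "norm x < r" and y: "norm y < r" for x y
  proof -
    have geo: "summable (\<lambda>n. (norm z / r) ^ n)" if "norm z < r" for z :: complex
      using that r by (intro summable_geometric) auto
    have bd: "norm (a i j * x ^ i * y ^ j) \<le> M * ((norm x / r) ^ i * (norm y / r) ^ j)" for i j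
      using mult_right_mono [OF a_bound [of i j], of "norm x ^ i * norm y ^ j"]
      by (simp add: norm_mult norm_power power_divide mult.assoc mult.commute [of "r ^ i"])
    have geo': "(\<lambda>n. (norm z / r) ^ n) summable_on UNIV" if "norm z < r" for z :: complex
      using geo [OF that] r by (intro norm_summable_imp_summable_on) auto
    \<comment> \<open>A product of two geometric series dominates the double series, so it may be
      summed over \<open>i\<close> first and then over \<open>j\<close>.\<close>
    have "(\<lambda>p. norm (M * ((norm x / r) ^ fst p * (norm y / r) ^ snd p))) summable_on UNIV \<times> UNIV"
    proof (rule Infinite_Sum.abs_summable_on_Sigma_iff [THEN iffD2], intro conjI ballI)
      show "(\<lambda>j. norm (M * ((norm x / r) ^ fst (i, j) * (norm y / r) ^ snd (i, j)))) summable_on UNIV" for i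
        using geo' [OF y] r \<open>0 \<le> M\<close> by (auto simp: abs_mult intro!: summable_on_cmult_right)
      show "(\<lambda>i. norm (\<Sum>\<^sub>\<infinity>j. norm (M * ((norm x / r) ^ fst (i, j) * (norm y / r) ^ snd (i, j))))) summable_on UNIV"
        using geo' [OF x] r \<open>0 \<le> M\<close>
        by (auto simp: abs_mult infsum_cmult_right' infsum_nonneg
            intro!: summable_on_cmult_right summable_on_cmult_left)
    qed
    then have "(\<lambda>p. norm (case p of (i, j) \<Rightarrow> a i j * x ^ i * y ^ j)) summable_on UNIV \<times> UNIV"
      by (rule Infinite_Sum.abs_summable_on_comparison_test) (use bd order.trans [OF bd abs_ge_self] in auto)
    then have S: "(\<lambda>(i, j). a i j * x ^ i * y ^ j) summable_on UNIV \<times> UNIV"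
      by (rule abs_summable_summable)
    have inner: "(\<Sum>\<^sub>\<infinity>i. a i j * x ^ i * y ^ j) = co j x * y ^ j" for j
    proof -
      have "summable (\<lambda>i. norm (a i j * x ^ i * y ^ j))"
        by (rule summable_comparison_test' [where g = "\<lambda>i. M * ((norm x / r) ^ i * (norm y / r) ^ j)"])
           (use bd geo [OF x] in \<open>auto intro!: summable_mult summable_mult2\<close>)
      moreover have "(\<lambda>i. a i j * x ^ i * y ^ j) sums (co j x * y ^ j)"
        using sums_mult2 [OF holomorphic_power_series [OF co_hol [of j], of x], of "y ^ j"] x r
        by (simp add: a_def)
      ultimately show ?thesis
        by (intro infsumI norm_summable_imp_has_sum)
    qed
    have "infsum (\<lambda>(i, j). a i j * x ^ i * y ^ j) (UNIV \<times> UNIV) =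
        (\<Sum>\<^sub>\<infinity>j. \<Sum>\<^sub>\<infinity>i. a i j * x ^ i * y ^ j)"
      using infsum_Sigma'_banach [OF S] infsum_swap_banach [OF S] by simp
    also have "\<dots> = (\<Sum>\<^sub>\<infinity>j. co j x * y ^ j)"
      by (simp add: inner)
    also have "\<dots> = f x y"
    proof (rule infsumI, rule norm_summable_imp_has_sum)
      show "summable (\<lambda>j. norm (co j x * y ^ j))"
      proof (rule summable_comparison_test' [where g = "\<lambda>j. M * (norm y / r) ^ j"])
        show "summable (\<lambda>j. M * (norm y / r) ^ j)"
          by (intro summable_mult geo y)
        show "norm (norm (co j x * y ^ j)) \<le> M * (norm y / r) ^ j" for j
          using mult_right_mono [OF co_bound [of x j], of "norm y ^ j"] x
          by (simp add: norm_mult norm_power power_divide)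
      qed
      show "(\<lambda>j. co j x * y ^ j) sums f x y"
        using holomorphic_power_series [OF hy, of x y] x y r by (simp add: co_def)
    qed
    finally show ?thesis
      using has_sum_infsum [OF S] by simp
  qed
  from that [OF r(1) this] show thesis .
qed

text \<open>At real arguments the monomials are real, so taking real parts of the coefficients gives
  the real part of \<open>f\<close>; this avoids proving that the coefficients themselves are
  real.\<close>

lemma bihol_dps:
  assumes "bihol d f" "0 < d" "f 0 0 = 1"
  obtains a e where "dps_convergent a" "0 < e"
    and "\<And>x y. \<bar>x\<bar> < e \<Longrightarrow> \<bar>y\<bar> < e \<Longrightarrow>
      Re (f (of_real x) (of_real y)) = 1 + dps_eval a x y"
proof -
  obtain b e where e: "0 < e"
    and b: "\<And>x y. norm x < e \<Longrightarrow> norm y < e \<Longrightarrow>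
        ((\<lambda>(i, j). b i j * x ^ i * y ^ j) has_sum f x y) UNIV"
    by (rule bihol_power_series [OF assms(1,2)], rule that)
  define a where "a i j = Re (b i j)" for i j
  have s: "((\<lambda>(i, j). a i j * x ^ i * y ^ j) has_sum Re (f (of_real x) (of_real y))) UNIV"
    if "\<bar>x\<bar> < e" "\<bar>y\<bar> < e" for x y :: real
  proof -
    have "((\<lambda>p. Re (case p of (i, j) \<Rightarrow> b i j * of_real x ^ i * of_real y ^ j)) has_sum
        Re (f (of_real x) (of_real y))) UNIV"
      using b [of "of_real x" "of_real y"] that by (intro has_sum_Re) auto
    also have "(\<lambda>p. Re (case p of (i, j) \<Rightarrow> b i j * of_real x ^ i * of_real y ^ j)) =
        (\<lambda>(i, j). a i j * x ^ i * y ^ j)"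
    proof (intro ext, clarify)
      fix i j
      have "b i j * of_real x ^ i * of_real y ^ j = b i j * of_real (x ^ i * y ^ j)"
        by simp
      then show "Re (b i j * of_real x ^ i * of_real y ^ j) = a i j * x ^ i * y ^ j"
        by (simp only: a_def) simp
    qed
    finally show ?thesis .
  qed
  \<comment> \<open>At the origin only the index (0, 0) contributes, as 0^0 = 1. Comparison with
    \<open>f 0 0\<close> then identifies the constant term.\<close>
  have zero: "((\<lambda>(i, j). a i j * 0 ^ i * 0 ^ j) has_sum a 0 0) UNIV"
  proof -
    have "((\<lambda>(i, j). a i j * 0 ^ i * 0 ^ j) has_sum a 0 0) {(0, 0)}"
      using has_sum_finite [of "{(0, 0)}" "\<lambda>(i, j). a i j * 0 ^ i * 0 ^ j"] by simp
    then show ?thesis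
      by (rule has_sum_cong_neutral [THEN iffD1, rotated -1]) (auto simp: power_0_left split: if_splits)
  qed
  have a00: "a 0 0 = 1"
    using has_sum_unique [OF zero s [of 0 0]] assms(3) e by simp
  have index: "UNIV - {(0, 0)} = dps_index"
    by (auto simp: dps_index_def)
  have t: "((\<lambda>(i, j). a i j * x ^ i * y ^ j) has_sum (Re (f (of_real x) (of_real y)) - 1)) dps_index"
    if "\<bar>x\<bar> < e" "\<bar>y\<bar> < e" for x y :: real
    using has_sum_Diff [OF s [OF that] has_sum_finite [of "{(0, 0)}"]] index
    by (simp add: a00)
  show thesis
  proof
    show "dps_convergent a"
      unfolding dps_convergent_def summable_on_def using e t by (intro exI [of _ e]) blast
    show "Re (f (of_real x) (of_real y)) = 1 + dps_eval a x y" if "\<bar>x\<bar> < e" "\<bar>y\<bar> < e" for x y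
      using infsumI [OF t [OF that]] by (simp add: dps_eval_def)
  qed (rule e)
qed

text \<open>On monomials this is the inverse of the Euler operator \<open>x \<partial>\<^sub>x + k y \<partial>\<^sub>y + a\<close> if
  \<open>\<phi> t = t^(a - 1)\<close>.\<close>

definition avg ::
  "(real \<Rightarrow> real) \<Rightarrow> real \<Rightarrow> (complex \<Rightarrow> complex \<Rightarrow> complex) \<Rightarrow> complex \<Rightarrow> complex \<Rightarrow> complex" where
  "avg \<phi> k f x y = integral {0..1} (\<lambda>t. of_real (\<phi> t) * f (of_real t * x) (of_real (t powr k) * y))"

text \<open>The real integral is a contour integral over the segment from 0 to 1, on which
  \<open>Re z\<close> recovers the parameter \<open>t\<close>.\<close>

lemma holomorphic_on_integral_param:
  fixes f :: "complex \<Rightarrow> real \<Rightarrow> complex"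
  assumes "open S" and cont: "continuous_on (S \<times> {0..1}) (\<lambda>(x, t). f x t)"
    and hol: "\<And>t. t \<in> {0..1} \<Longrightarrow> (\<lambda>x. f x t) holomorphic_on S"
  shows "(\<lambda>x. integral {0..1} (f x)) holomorphic_on S"
proof -
  have seg: "closed_segment 0 (1::complex) = of_real ` {0..1}"
    by (auto simp: closed_segment_def image_iff scaleR_conv_of_real Bex_def)
  have "(\<lambda>x. contour_integral (linepath 0 1) (\<lambda>z. f x (Re z))) holomorphic_on S"
  proof (rule holomorphic_on_contour_integral_param [OF \<open>open S\<close>])
    have "continuous_on (S \<times> path_image (linepath 0 (1::complex))) (\<lambda>p. (\<lambda>(x, t). f x t) (fst p, Re (snd p)))"
      by (rule continuous_on_compose2 [OF cont]) (auto simp: seg intro!: continuous_intros)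
    then show "continuous_on (S \<times> path_image (linepath 0 (1::complex))) (\<lambda>(x, z). f x (Re z))"
      by (simp add: case_prod_unfold)
    show "(\<lambda>x. f x (Re z)) holomorphic_on S" if "z \<in> path_image (linepath 0 1)" for z :: complex
      using that hol by (auto simp: seg)
  qed (auto intro!: continuous_intros)
  moreover have "contour_integral (linepath 0 1) (\<lambda>z. f x (Re z)) = integral {0..1} (f x)" for x
    by (auto simp: contour_integral_integral linepath_def intro!: integral_cong)
  ultimately show ?thesis by simp
qed

lemma scaled_in_ball:
  assumes "x \<in> ball (0::complex) d" "\<bar>s\<bar> \<le> 1"
  shows "of_real s * x \<in> ball 0 d"
  using assms mult_left_le_one_le [of "norm x" "\<bar>s\<bar>"] by (auto simp: norm_mult)

lemma powr_unit_le_one: "t \<in> {0..1} \<Longrightarrow> 0 \<le> k \<Longrightarrow> \<bar>t powr k\<bar> \<le> (1::real)"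
  by (simp add: powr_le1)

lemma continuous_on_powr_unit: "0 < k \<Longrightarrow> continuous_on {0..1} (\<lambda>t::real. t powr k)"
  by (intro continuous_on_powr') (auto intro!: continuous_intros)

text \<open>Invariance under the weighted dilations over which \<open>avg\<close> integrates. On
  such a set \<open>avg\<close> uses only values from the set, which allows one estimate to cover
  both the bidisc and the real curve.\<close>

definition star_like :: "real \<Rightarrow> (complex \<times> complex) set \<Rightarrow> bool" where
  "star_like k S \<longleftrightarrow> (\<forall>(x, y)\<in>S. \<forall>t\<in>{0..1}. (of_real t * x, of_real (t powr k) * y) \<in> S)"

lemma star_like_bidisc: "0 < k \<Longrightarrow> star_like k (ball 0 d \<times> ball 0 d)"
  using scaled_in_ball [of _ d] powr_unit_le_one [of _ k] by (force simp: star_like_def)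

lemma continuous_on_avg_integrand:
  fixes f :: "complex \<Rightarrow> complex \<Rightarrow> complex"
  assumes cont: "continuous_on S (\<lambda>(x, y). f x y)"
    and S: "star_like k S" and "0 < k" and phi: "continuous_on {0..1} \<phi>"
  shows "continuous_on (S \<times> {0..1})
      (\<lambda>((x, y), t). of_real (\<phi> t) * f (of_real t * x) (of_real (t powr k) * y))"
proof -
  have pw: "continuous_on (S \<times> {0..1}) (\<lambda>p. h (snd p))"
    if "continuous_on {0..1} h" for h :: "real \<Rightarrow> real"
    by (rule continuous_on_compose2 [OF that]) (auto intro!: continuous_intros)
  have "continuous_on (S \<times> {0..1})
      (\<lambda>p. (\<lambda>(x, y). f x y) (of_real (snd p) * fst (fst p), of_real (snd p powr k) * snd (fst p)))"
    using \<open>0 < k\<close>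
    by (intro continuous_on_compose2 [OF cont] continuous_intros pw [OF continuous_on_powr_unit])
       (use S in \<open>auto simp: star_like_def\<close>)
  then show ?thesis
    using pw [OF phi] by (auto simp: case_prod_unfold intro!: continuous_intros)
qed

lemma continuous_on_avg:
  assumes "continuous_on S (\<lambda>(x, y). f x y)" "star_like k S" "0 < k" "continuous_on {0..1} \<phi>"
  shows "continuous_on S (\<lambda>(x, y). avg \<phi> k f x y)"
  using integral_continuous_on_param [of S 0 1
      "\<lambda>p t. of_real (\<phi> t) * f (of_real t * fst p) (of_real (t powr k) * snd p)"]
    continuous_on_avg_integrand [OF assms]
  by (simp add: avg_def case_prod_unfold)

text \<open>The weight is at most 1 and the interval has length 1, so averaging does not increase
  the sup distance on a star-like set.\<close>

lemma norm_avg_diff_le: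
  assumes f: "continuous_on S (\<lambda>(x, y). f x y)" and g: "continuous_on S (\<lambda>(x, y). g x y)"
    and S: "star_like k S" and "0 < k" and phi: "continuous_on {0..1} \<phi>"
    and phi_le: "\<And>t. t \<in> {0..1} \<Longrightarrow> \<bar>\<phi> t\<bar> \<le> 1"
    and D: "\<And>x y. (x, y) \<in> S \<Longrightarrow> norm (f x y - g x y) \<le> D" and xy: "(x, y) \<in> S"
  shows "norm (avg \<phi> k f x y - avg \<phi> k g x y) \<le> D"
proof -
  have int: "(\<lambda>t. of_real (\<phi> t) * h (of_real t * x) (of_real (t powr k) * y)) integrable_on {0..1}"
    if h: "continuous_on S (\<lambda>(x, y). h x y)" for h :: "complex \<Rightarrow> complex \<Rightarrow> complex"
  proof (rule integrable_continuous_real)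
    have "continuous_on {0..1} (\<lambda>t. (\<lambda>((x, y), t). of_real (\<phi> t) *
        h (of_real t * x) (of_real (t powr k) * y)) ((x, y), t))"
      by (rule continuous_on_compose2 [OF continuous_on_avg_integrand [OF h S \<open>0 < k\<close> phi]])
         (use xy in \<open>auto intro!: continuous_intros\<close>)
    then show "continuous_on {0..1} (\<lambda>t. of_real (\<phi> t) * h (of_real t * x) (of_real (t powr k) * y))"
      by simp
  qed
  have "0 \<le> D" using order.trans [OF norm_ge_zero D [OF xy]] .
  have "avg \<phi> k f x y - avg \<phi> k g x y = integral {0..1} (\<lambda>t.
      of_real (\<phi> t) * f (of_real t * x) (of_real (t powr k) * y) -
      of_real (\<phi> t) * g (of_real t * x) (of_real (t powr k) * y))"
    unfolding avg_def by (rule integral_diff [symmetric]; rule int; fact)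
  also have "norm \<dots> \<le> integral {0..1} (\<lambda>t::real. D)"
  proof (rule integral_norm_bound_integral)
    fix t :: real assume t: "t \<in> {0..1}"
    have "norm (f (of_real t * x) (of_real (t powr k) * y) - g (of_real t * x) (of_real (t powr k) * y)) \<le> D"
      using S xy t by (intro D) (auto simp: star_like_def)
    then have "\<bar>\<phi> t\<bar> * norm (f (of_real t * x) (of_real (t powr k) * y) - g (of_real t * x) (of_real (t powr k) * y)) \<le> 1 * D"
      using phi_le [OF t] by (intro mult_mono) auto
    then show "norm (of_real (\<phi> t) * f (of_real t * x) (of_real (t powr k) * y) -
        of_real (\<phi> t) * g (of_real t * x) (of_real (t powr k) * y)) \<le> D"
      by (simp add: norm_mult flip: right_diff_distrib)
  qed (auto intro!: integrable_diff int f g)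
  finally show ?thesis by simp
qed

lemma bihol_avg:
  assumes f: "bihol d f" and "0 < k" and phi: "continuous_on {0..1} \<phi>"
  shows "bihol d (avg \<phi> k f)"
proof -
  have cont: "continuous_on ((ball 0 d \<times> ball 0 d) \<times> {0..1})
      (\<lambda>((x, y), t). of_real (\<phi> t) * f (of_real t * x) (of_real (t powr k) * y))"
    using assms by (intro continuous_on_avg_integrand star_like_bidisc) (auto simp: bihol_def)
  have "continuous_on (ball 0 d \<times> ball 0 d) (\<lambda>(x, y). avg \<phi> k f x y)"
    using assms by (intro continuous_on_avg star_like_bidisc) (auto simp: bihol_def)
  moreover have "(\<lambda>x. avg \<phi> k f x y) holomorphic_on ball 0 d" if y: "y \<in> ball 0 d" for y
    unfolding avg_def
  proof (rule holomorphic_on_integral_param [OF open_ball])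
    have "continuous_on (ball 0 d \<times> {0..1}) (\<lambda>p. (\<lambda>((x, y), t). of_real (\<phi> t) *
        f (of_real t * x) (of_real (t powr k) * y)) ((fst p, y), snd p))"
      by (rule continuous_on_compose2 [OF cont]) (use y in \<open>auto intro!: continuous_intros\<close>)
    then show "continuous_on (ball 0 d \<times> {0..1})
        (\<lambda>(x, t). of_real (\<phi> t) * f (of_real t * x) (of_real (t powr k) * y))"
      by (simp add: case_prod_unfold)
    show "(\<lambda>x. of_real (\<phi> t) * f (of_real t * x) (of_real (t powr k) * y)) holomorphic_on ball 0 d"
      if t: "t \<in> {0..1}" for t
    proof -
      have "(\<lambda>x. f x (of_real (t powr k) * y)) holomorphic_on ball 0 d"
        using f scaled_in_ball [OF y powr_unit_le_one [OF t, of k]] \<open>0 < k\<close> by (simp add: bihol_def)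
      then have "((\<lambda>x. f x (of_real (t powr k) * y)) \<circ> (\<lambda>x. of_real t * x)) holomorphic_on ball 0 d"
        by (intro holomorphic_on_compose_gen [where t = "ball 0 d"] holomorphic_intros)
           (use t in \<open>auto intro!: scaled_in_ball simp del: mem_ball\<close>)
      then show ?thesis
        by (intro holomorphic_intros) (simp add: o_def)
    qed
  qed
  moreover have "(\<lambda>y. avg \<phi> k f x y) holomorphic_on ball 0 d" if x: "x \<in> ball 0 d" for x
    unfolding avg_def
  proof (rule holomorphic_on_integral_param [OF open_ball])
    have "continuous_on (ball 0 d \<times> {0..1}) (\<lambda>p. (\<lambda>((x, y), t). of_real (\<phi> t) *
        f (of_real t * x) (of_real (t powr k) * y)) ((x, fst p), snd p))"
      by (rule continuous_on_compose2 [OF cont]) (use x in \<open>auto intro!: continuous_intros\<close>)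
    then show "continuous_on (ball 0 d \<times> {0..1})
        (\<lambda>(y, t). of_real (\<phi> t) * f (of_real t * x) (of_real (t powr k) * y))"
      by (simp add: case_prod_unfold)
    show "(\<lambda>y. of_real (\<phi> t) * f (of_real t * x) (of_real (t powr k) * y)) holomorphic_on ball 0 d"
      if t: "t \<in> {0..1}" for t
    proof -
      have "(\<lambda>y. f (of_real t * x) y) holomorphic_on ball 0 d"
        using f scaled_in_ball [OF x, of t] t by (simp add: bihol_def)
      then have "((\<lambda>y. f (of_real t * x) y) \<circ> (\<lambda>y. of_real (t powr k) * y)) holomorphic_on ball 0 d"
        by (intro holomorphic_on_compose_gen [where t = "ball 0 d"] holomorphic_intros)
           (use t \<open>0 < k\<close> in \<open>auto intro!: scaled_in_ball powr_unit_le_one simp del: mem_ball\<close>)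
      then show ?thesis
        by (intro holomorphic_intros) (simp add: o_def)
    qed
  qed
  ultimately show ?thesis
    by (simp add: bihol_def)
qed

lemma bihol_const: "bihol d (\<lambda>_ _. a)"
  by (simp add: bihol_def case_prod_unfold)

lemma bihol_fst: "bihol d (\<lambda>x _. x)"
  by (auto simp: bihol_def case_prod_unfold intro!: continuous_intros holomorphic_intros)

lemma bihol_mult: "bihol d f \<Longrightarrow> bihol d g \<Longrightarrow> bihol d (\<lambda>x y. f x y * g x y)"
  by (auto simp: bihol_def case_prod_unfold intro!: continuous_intros holomorphic_intros)

lemma bihol_compose:
  assumes f: "bihol d f" and h: "h holomorphic_on T"
    and T: "\<And>x y. x \<in> ball 0 d \<Longrightarrow> y \<in> ball 0 d \<Longrightarrow> f x y \<in> T"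
  shows "bihol d (\<lambda>x y. h (f x y))"
  unfolding bihol_def
proof (intro conjI ballI)
  have "continuous_on (ball 0 d \<times> ball 0 d) (\<lambda>p. h ((\<lambda>(x, y). f x y) p))"
    by (rule continuous_on_compose2 [OF holomorphic_on_imp_continuous_on [OF h]])
       (use f T in \<open>auto simp: bihol_def simp del: mem_ball\<close>)
  then show "continuous_on (ball 0 d \<times> ball 0 d) (\<lambda>(x, y). h (f x y))"
    by (simp add: case_prod_unfold)
  show "(\<lambda>x. h (f x y)) holomorphic_on ball 0 d" if y: "y \<in> ball 0 d" for y
  proof -
    have "(\<lambda>x. f x y) holomorphic_on ball 0 d" "(\<lambda>x. f x y) ` ball 0 d \<subseteq> T"
      using f T y unfolding bihol_def by blast+
    then show ?thesis
      using holomorphic_on_compose_gen [OF _ h] by (simp add: o_def)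
  qed
  show "(\<lambda>y. h (f x y)) holomorphic_on ball 0 d" if x: "x \<in> ball 0 d" for x
  proof -
    have "f x holomorphic_on ball 0 d" "f x ` ball 0 d \<subseteq> T"
      using f T x unfolding bihol_def by blast+
    then show ?thesis
      using holomorphic_on_compose_gen [OF _ h] by (simp add: o_def)
  qed
qed

section \<open>A singular initial value problem\<close>

text \<open>A disc of radius \<open>r\<close> about a point of \<open>cball z r\<close> stays in
  \<open>cball z (2 * r)\<close>, so Cauchy's estimate bounds the derivative by
  \<open>C / r\<close>; convexity of the smaller disc turns this into a Lipschitz bound.\<close>

lemma holomorphic_lipschitz:
  fixes f :: "complex \<Rightarrow> complex"
  assumes hol: "f holomorphic_on ball z (4 * r)" and "0 < r"
    and C: "\<And>w. w \<in> cball z (2 * r) \<Longrightarrow> norm (f w) \<le> C"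
    and ab: "a \<in> cball z r" "b \<in> cball z r"
  shows "norm (f a - f b) \<le> C / r * norm (a - b)"
proof (rule field_differentiable_bound [where S = "cball z r" and f' = "deriv f"])
  fix w assume w: "w \<in> cball z r"
  have in2: "cball w r \<subseteq> cball z (2 * r)"
  proof
    fix p assume "p \<in> cball w r"
    then show "p \<in> cball z (2 * r)"
      using w dist_triangle [of z p w] by auto
  qed
  have in4: "cball z (2 * r) \<subseteq> ball z (4 * r)" using \<open>0 < r\<close> by auto
  show "(f has_field_derivative deriv f w) (at w within cball z r)"
    using holomorphic_derivI [OF hol open_ball, of w] w in4 \<open>0 < r\<close>
    by (auto intro: has_field_derivative_at_within)
  have "norm ((deriv ^^ 1) f w) \<le> fact 1 * C / r ^ 1"
  proof (rule Cauchy_inequality)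
    show "f holomorphic_on ball w r" "continuous_on (cball w r) f"
      using in2 in4 ball_subset_cball [of w r]
      by (meson holomorphic_on_imp_continuous_on holomorphic_on_subset [OF hol] order.trans)+
    show "norm (f x) \<le> C" if "norm (w - x) = r" for x
      using in2 that by (intro C) (auto simp: dist_norm)
  qed fact
  then show "norm (deriv f w) \<le> C / r" by simp
qed (use ab in auto)

text \<open>Holomorphy in several variables is phrased as stability under substitution of
  holomorphic functions of one variable, the form in which the iteration uses it.
  \<open>F_indep\<close> is the source of the contraction, and \<open>F_one\<close> says that the
  value 1 at the origin is consistent with the fixed point equation.\<close>

locale singular_ivp =
  fixes F :: "complex \<Rightarrow> complex \<Rightarrow> complex \<Rightarrow> complex \<Rightarrow> complex"
    and E :: "complex \<Rightarrow> complex \<Rightarrow> complex"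
    and \<phi> :: "real \<Rightarrow> real" and k d :: real
  assumes d: "0 < d" and k: "0 < k"
    and phi: "continuous_on {0..1} \<phi>" and phi_le: "\<And>t. t \<in> {0..1} \<Longrightarrow> \<bar>\<phi> t\<bar> \<le> 1"
    and contF: "continuous_on (ball 0 d \<times> ball 0 d \<times> ball 1 d \<times> ball 0 d) (\<lambda>(x, y, w, v). F x y w v)"
    and holF: "\<And>S a b w v. open S \<Longrightarrow> a holomorphic_on S \<Longrightarrow> b holomorphic_on S \<Longrightarrow>
      w holomorphic_on S \<Longrightarrow> v holomorphic_on S \<Longrightarrow>
      (\<And>z. z \<in> S \<Longrightarrow> a z \<in> ball 0 d \<and> b z \<in> ball 0 d \<and> w z \<in> ball 1 d \<and> v z \<in> ball 0 d) \<Longrightarrow>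
      (\<lambda>z. F (a z) (b z) (w z) (v z)) holomorphic_on S"
    and contE: "continuous_on (ball 0 d \<times> ball 1 d) (\<lambda>(x, w). E x w)"
    and holE: "\<And>S a w. open S \<Longrightarrow> a holomorphic_on S \<Longrightarrow> w holomorphic_on S \<Longrightarrow>
      (\<And>z. z \<in> S \<Longrightarrow> a z \<in> ball 0 d \<and> w z \<in> ball 1 d) \<Longrightarrow>
      (\<lambda>z. E (a z) (w z)) holomorphic_on S"
    and F_indep: "\<And>w v. w \<in> ball 1 d \<Longrightarrow> v \<in> ball 0 d \<Longrightarrow> F 0 0 w v = F 0 0 1 v"
    and F_one: "F 0 0 1 0 = 1"
begin

text \<open>This solves the second equation of the overview for \<open>v\<close> in terms of
  \<open>w\<close>, which leaves a fixed point problem for \<open>w\<close> alone.\<close>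

definition deficit :: "(complex \<Rightarrow> complex \<Rightarrow> complex) \<Rightarrow> complex \<Rightarrow> complex \<Rightarrow> complex" where
  "deficit w x y = y * avg \<phi> k (\<lambda>x y. E x (w x y)) x y"

definition picard :: "(complex \<Rightarrow> complex \<Rightarrow> complex) \<Rightarrow> complex \<Rightarrow> complex \<Rightarrow> complex" where
  "picard w = avg (\<lambda>_. 1) k (\<lambda>x y. F x y (w x y) (deficit w x y))"

text \<open>The quantifier over all star-like \<open>S\<close> makes one radius serve for the bidisc
  and for the curve. The estimates hold for functions with values within \<open>d / 4\<close> of 1;
  the contraction factor is 1/2.\<close>

definition contraction_radius :: "real \<Rightarrow> bool" where
  "contraction_radius e \<longleftrightarrow> 0 < e \<and> e < d \<and>
    (\<forall>S w. S \<subseteq> ball 0 e \<times> ball 0 e \<longrightarrow> star_like k S \<longrightarrow> continuous_on S (\<lambda>(x, y). w x y) \<longrightarrow>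
       (\<forall>(x, y)\<in>S. w x y \<in> cball 1 (d / 4)) \<longrightarrow>
       (\<forall>(x, y)\<in>S. deficit w x y \<in> cball 0 (d / 4)) \<and>
       (\<forall>(x, y)\<in>S. picard w x y \<in> cball 1 (d / 4)) \<and>
       (\<forall>w' D. continuous_on S (\<lambda>(x, y). w' x y) \<longrightarrow>
         (\<forall>(x, y)\<in>S. w' x y \<in> cball 1 (d / 4)) \<longrightarrow>
         (\<forall>(x, y)\<in>S. norm (w x y - w' x y) \<le> D) \<longrightarrow>
         (\<forall>(x, y)\<in>S. norm (picard w x y - picard w' x y) \<le> D / 2)))"

lemma continuous_on_E:
  assumes "S \<subseteq> ball 0 d \<times> ball 0 d" "continuous_on S (\<lambda>(x, y). w x y)"
    and "\<forall>(x, y)\<in>S. w x y \<in> cball 1 (d / 4)"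
  shows "continuous_on S (\<lambda>(x, y). E x (w x y))"
proof -
  have "continuous_on S (\<lambda>p. (\<lambda>(x, w). E x w) (fst p, (\<lambda>(x, y). w x y) p))"
    by (intro continuous_on_compose2 [OF contE] continuous_intros assms)
       (use assms d in fastforce)
  then show ?thesis by (simp add: case_prod_unfold)
qed

lemma continuous_on_deficit:
  assumes "S \<subseteq> ball 0 d \<times> ball 0 d" "star_like k S" "continuous_on S (\<lambda>(x, y). w x y)"
    and "\<forall>(x, y)\<in>S. w x y \<in> cball 1 (d / 4)"
  shows "continuous_on S (\<lambda>(x, y). deficit w x y)"
  using continuous_on_avg [OF continuous_on_E assms(2) k phi] assms
  unfolding deficit_def case_prod_unfold by (intro continuous_intros) auto

lemma continuous_on_F:
  assumes "S \<subseteq> ball 0 d \<times> ball 0 d" "star_like k S" "continuous_on S (\<lambda>(x, y). w x y)"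
    and "\<forall>(x, y)\<in>S. w x y \<in> cball 1 (d / 4)"
    and "\<forall>(x, y)\<in>S. deficit w x y \<in> cball 0 (d / 4)"
  shows "continuous_on S (\<lambda>(x, y). F x y (w x y) (deficit w x y))"
proof -
  have "continuous_on S (\<lambda>p. (\<lambda>(x, y, w, v). F x y w v)
      (fst p, snd p, (\<lambda>(x, y). w x y) p, (\<lambda>(x, y). deficit w x y) p))"
    by (intro continuous_on_compose2 [OF contF] continuous_intros continuous_on_deficit assms(1-4))
       (use assms d in fastforce)
  then show ?thesis by (simp add: case_prod_unfold)
qed

lemma bounded_on_compact:
  fixes f :: "'a::metric_space \<Rightarrow> complex"
  assumes "compact K" "continuous_on K f"
  obtains C where "0 < C" "\<And>x. x \<in> K \<Longrightarrow> norm (f x) \<le> C"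
  using compact_imp_bounded [OF compact_continuous_image [OF assms(2,1)]]
  unfolding bounded_pos by (auto intro: that)

text \<open>Two effects must be small on a small bidisc: the direct dependence of \<open>F\<close>
  on \<open>w\<close>, which disappears at x = y = 0, and the dependence through the deficit, which
  carries the factor \<open>y\<close>.\<close>

lemma contraction_radius_exists:
  obtains e where "contraction_radius e"
proof -
  \<comment> \<open>The Lipschitz lemma on radius \<open>\<rho>\<close> needs bounds on radius
    \<open>2 * \<rho>\<close> and holomorphy on radius \<open>4 * \<rho>\<close>, which is exactly
    \<open>d\<close>.\<close>
  define \<rho> where "\<rho> = d / 4"
  have \<rho>: "0 < \<rho>" "4 * \<rho> = d" "2 * \<rho> = d / 2" using d by (auto simp: \<rho>_def)
  have sub: "cball z (2 * \<rho>) \<subseteq> ball z d" "cball z \<rho> \<subseteq> cball z (2 * \<rho>)" for z :: complex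
    using \<rho> by auto
  let ?K = "cball (0::complex) (2 * \<rho>) \<times> cball (0::complex) (2 * \<rho>) \<times> cball (1::complex) (2 * \<rho>) \<times> cball (0::complex) (2 * \<rho>)"
  have cK: "continuous_on ?K (\<lambda>(x, y, w, v). F x y w v)"
    by (rule continuous_on_subset [OF contF]) (use sub in auto)
  have compK: "compact ?K"
    by (intro compact_Times compact_cball)
  obtain CF where CF: "0 < CF"
    and CF0: "\<And>p. p \<in> ?K \<Longrightarrow> norm ((\<lambda>(x, y, w, v). F x y w v) p) \<le> CF"
    by (rule bounded_on_compact [OF compK cK]) (rule that)
  have CF': "norm (F x y w v) \<le> CF"
    if "norm x \<le> 2 * \<rho>" "norm y \<le> 2 * \<rho>" "w \<in> cball 1 (2 * \<rho>)" "norm v \<le> 2 * \<rho>" for x y w v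
    using CF0 [of "(x, y, w, v)"] that by simp
  have cE: "continuous_on (cball 0 (2 * \<rho>) \<times> cball 1 (2 * \<rho>)) (\<lambda>(x, w). E x w)"
    by (rule continuous_on_subset [OF contE]) (use sub in auto)
  obtain CE where CE: "0 < CE"
    and CE0: "\<And>p. p \<in> cball 0 (2 * \<rho>) \<times> cball 1 (2 * \<rho>) \<Longrightarrow> norm ((\<lambda>(x, w). E x w) p) \<le> CE"
    by (rule bounded_on_compact [OF compact_Times [OF compact_cball compact_cball] cE]) (rule that)
  have CE': "norm (E x w) \<le> CE" if "norm x \<le> 2 * \<rho>" "w \<in> cball 1 (2 * \<rho>)" for x w
    using CE0 [of "(x, w)"] that by simp
  \<comment> \<open>The tolerance \<open>\<rho> / 4\<close> is chosen because division by the radius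
    \<open>\<rho>\<close> then gives the Lipschitz constant 1/4 in \<open>w\<close>.\<close>
  have "uniformly_continuous_on ?K (\<lambda>(x, y, w, v). F x y w v)"
    by (rule compact_uniformly_continuous [OF cK compK])
  then obtain \<eta> where \<eta>: "0 < \<eta>"
    and unif: "\<And>p q. p \<in> ?K \<Longrightarrow> q \<in> ?K \<Longrightarrow> dist q p < \<eta> \<Longrightarrow>
      dist ((\<lambda>(x, y, w, v). F x y w v) q) ((\<lambda>(x, y, w, v). F x y w v) p) < \<rho> / 4"
    unfolding uniformly_continuous_on_def using \<rho>(1) by (metis divide_pos_pos zero_less_numeral)
  have small: "norm (F x y w v - F 0 0 1 v) \<le> \<rho> / 4"
    if "norm x < \<eta> / 2" "norm y < \<eta> / 2" "norm x \<le> 2 * \<rho>" "norm y \<le> 2 * \<rho>"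
      "w \<in> cball 1 (2 * \<rho>)" "norm v \<le> 2 * \<rho>" for x y w v
  proof -
    have "dist (x, y, w, v) (0, 0, w, v) \<le> norm x + norm y"
      using real_sqrt_sum_squares_triangle_ineq [of "norm x" 0 0 "norm y"]
      by (simp add: dist_Pair_Pair)
    then have "dist (x, y, w, v) (0, 0, w, v) < \<eta>"
      using that by linarith
    then have "norm (F x y w v - F 0 0 w v) < \<rho> / 4"
      using unif [of "(0, 0, w, v)" "(x, y, w, v)"] that \<rho> by (simp add: dist_norm)
    moreover have "F 0 0 w v = F 0 0 1 v"
      using that sub(1) [of 1] \<rho> by (intro F_indep) auto
    ultimately show ?thesis by simp
  qed
  \<comment> \<open>The Lipschitz constant in \<open>w\<close> is small because \<open>F x y w v\<close> is uniformly close to the function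
    \<open>F 0 0 1 v\<close>, which is constant in \<open>w\<close>.\<close>
  have lipw: "norm (F x y w v - F x y w' v) \<le> 1 / 4 * norm (w - w')"
    if "norm x < \<eta> / 2" "norm y < \<eta> / 2" "norm x \<le> 2 * \<rho>" "norm y \<le> 2 * \<rho>"
      "w \<in> cball 1 \<rho>" "w' \<in> cball 1 \<rho>" "norm v \<le> \<rho>" for x y w w' v
  proof -
    have "norm ((F x y w v - F 0 0 1 v) - (F x y w' v - F 0 0 1 v)) \<le> (\<rho> / 4) / \<rho> * norm (w - w')"
    proof (rule holomorphic_lipschitz [where z = 1])
      show "(\<lambda>w. F x y w v - F 0 0 1 v) holomorphic_on ball 1 (4 * \<rho>)"
        using that \<rho> by (intro holomorphic_intros holF) auto
      show "norm (F x y w v - F 0 0 1 v) \<le> \<rho> / 4" if "w \<in> cball 1 (2 * \<rho>)" for w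
        using \<open>norm v \<le> \<rho>\<close> \<rho>(1) by (intro small that \<open>norm x < \<eta> / 2\<close> \<open>norm y < \<eta> / 2\<close>
          \<open>norm x \<le> 2 * \<rho>\<close> \<open>norm y \<le> 2 * \<rho>\<close>) auto
    qed (use that \<rho> in auto)
    then show ?thesis using \<rho>(1) by simp
  qed
  have lipv: "norm (F x y w v - F x y w v') \<le> CF / \<rho> * norm (v - v')"
    if "norm x \<le> 2 * \<rho>" "norm y \<le> 2 * \<rho>"
      "w \<in> cball 1 \<rho>" "norm v \<le> \<rho>" "norm v' \<le> \<rho>" for x y w v v'
  proof (rule holomorphic_lipschitz [where z = 0])
    show "F x y w holomorphic_on ball 0 (4 * \<rho>)"
      using that \<rho> by (intro holF) auto
  qed (use that \<rho> in \<open>auto intro!: CF'\<close>)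
  have lipE: "norm (E x w - E x w') \<le> CE / \<rho> * norm (w - w')"
    if "norm x \<le> 2 * \<rho>" "w \<in> cball 1 \<rho>" "w' \<in> cball 1 \<rho>" for x w w'
  proof (rule holomorphic_lipschitz [where z = 1])
    show "E x holomorphic_on ball 1 (4 * \<rho>)"
      using that \<rho> by (intro holE) auto
  qed (use that \<rho> in \<open>auto intro!: CE'\<close>)
  define c where "c = CF / \<rho> * CE"
  have c: "0 < c" using CF CE \<rho> by (simp add: c_def)
  \<comment> \<open>In this order the bounds ensure: (x, y) is within reach of uniform continuity,
    it lies in the compact set, the deficit is at most \<open>\<rho>\<close>, the deficit moves
    \<open>F\<close> by at most \<open>\<rho> / 2\<close>, and it contributes at most 1/4 to the
    Lipschitz constant. The constant \<open>c\<close> is the Lipschitz constant of \<open>F\<close>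
    in \<open>v\<close> times the bound on \<open>E\<close>.\<close>
  define e where "e = Min {\<eta> / 2, 2 * \<rho>, \<rho> / CE, \<rho> / 2 / c, \<rho> / 4 / c}"
  have "0 < e"
    using \<eta> \<rho> CE c by (simp add: e_def)
  moreover have "e \<le> \<eta> / 2" "e \<le> 2 * \<rho>" "e \<le> \<rho> / CE" "e \<le> \<rho> / 2 / c" "e \<le> \<rho> / 4 / c"
    unfolding e_def by (rule Min_le; simp)+
  ultimately have "0 < e" "e \<le> \<eta> / 2" "e \<le> 2 * \<rho>" "e * CE \<le> \<rho>" "e * c \<le> \<rho> / 2" "e * c \<le> \<rho> / 4"
    using CE c by (simp_all add: pos_le_divide_eq del: divide_divide_eq_left)
  moreover have "CF / \<rho> * (e * CE) = e * c" "CF / \<rho> * (e * (CE / \<rho>)) = e * c / \<rho>"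
    by (simp_all add: c_def)
  ultimately have e: "0 < e" "e \<le> \<eta> / 2" "e \<le> 2 * \<rho>" "e * CE \<le> \<rho>"
      "CF / \<rho> * (e * CE) \<le> \<rho> / 2" "CF / \<rho> * (e * (CE / \<rho>)) \<le> 1 / 4"
    using \<rho>(1) by (simp_all add: pos_divide_le_eq)
  have "contraction_radius e"
    unfolding contraction_radius_def
  proof (intro conjI allI impI)
    show "0 < e" "e < d" using e \<rho> by auto
    fix S :: "(complex \<times> complex) set" and w :: "complex \<Rightarrow> complex \<Rightarrow> complex"
    assume S: "S \<subseteq> ball 0 e \<times> ball 0 e" "star_like k S"
      and w: "continuous_on S (\<lambda>(x, y). w x y)" "\<forall>(x, y)\<in>S. w x y \<in> cball 1 (d / 4)"
    have S': "S \<subseteq> ball 0 d \<times> ball 0 d"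
      using e(3) \<rho>(1,2) by (intro order.trans [OF S(1)] Sigma_mono) auto
    have Sx: "norm x < e" "norm y < e" if "(x, y) \<in> S" for x y
      using S(1) that by auto
    have zero: "avg \<psi> k (\<lambda>_ _. 0) x y = 0" for \<psi> x y
      by (simp add: avg_def)
    have def_le: "norm (deficit w x y) \<le> e * CE"
      if w: "continuous_on S (\<lambda>(x, y). w x y)" "\<forall>(x, y)\<in>S. w x y \<in> cball 1 (d / 4)" and xy: "(x, y) \<in> S" for w x y
    proof -
      have "norm (avg \<phi> k (\<lambda>x y. E x (w x y)) x y - avg \<phi> k (\<lambda>_ _. 0) x y) \<le> CE"
      proof (rule norm_avg_diff_le [OF continuous_on_E [OF S' w] _ S(2) k phi phi_le _ xy])
        show "norm (E x (w x y) - 0) \<le> CE" if "(x, y) \<in> S" for x y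
          using that w(2) Sx [OF that] e \<rho> by (auto intro!: CE')
      qed auto
      then show ?thesis
        using Sx [OF xy] e(1) unfolding deficit_def norm_mult zero
        by (intro mult_mono) auto
    qed
    have def_ball: "\<forall>(x, y)\<in>S. deficit w x y \<in> cball 0 (d / 4)"
      if w: "continuous_on S (\<lambda>(x, y). w x y)" "\<forall>(x, y)\<in>S. w x y \<in> cball 1 (d / 4)" for w
      using order.trans [OF def_le [OF w] e(4)] by (auto simp: \<rho>_def)
    show "\<forall>(x, y)\<in>S. deficit w x y \<in> cball 0 (d / 4)"
      by (rule def_ball [OF w])
    note contFw = continuous_on_F [OF S' S(2) _ _ def_ball]
    show "\<forall>(x, y)\<in>S. picard w x y \<in> cball 1 (d / 4)"
    proof clarify
      fix x y assume xy: "(x, y) \<in> S"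
      have "norm (avg (\<lambda>_. 1) k (\<lambda>x y. F x y (w x y) (deficit w x y)) x y - avg (\<lambda>_. 1) k (\<lambda>_ _. 1) x y) \<le> \<rho>"
      proof (rule norm_avg_diff_le [OF contFw [OF w w] _ S(2) k _ _ _ xy])
        fix x y assume xy: "(x, y) \<in> S"
        let ?v = "deficit w x y"
        have v: "norm ?v \<le> \<rho>" and wb: "w x y \<in> cball 1 \<rho>"
          using def_ball [OF w] w(2) xy by (auto simp: \<rho>_def)
        \<comment> \<open>The distance to 1 is split at \<open>F 0 0 1 ?v\<close>: \<rho>/4 from
          uniform continuity plus \<rho>/2 from the deficit stays below \<rho>.\<close>
        have "norm (F x y (w x y) ?v - F 0 0 1 ?v) \<le> \<rho> / 4"
          using Sx [OF xy] e v wb sub(2) [of 1] \<rho> by (intro small) auto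
        moreover have "norm (F 0 0 1 ?v - F 0 0 1 0) \<le> CF / \<rho> * norm (?v - 0)"
          using v \<rho> by (intro lipv) auto
        moreover have "CF / \<rho> * norm (?v - 0) \<le> CF / \<rho> * (e * CE)"
          using def_le [OF w xy] CF \<rho> by (intro mult_left_mono) auto
        ultimately show "norm (F x y (w x y) ?v - 1) \<le> \<rho>"
          using e(5) norm_triangle_ineq [of "F x y (w x y) ?v - F 0 0 1 ?v" "F 0 0 1 ?v - 1"] \<rho>(1)
          unfolding F_one by simp
      qed (auto intro: continuous_intros)
      then show "picard w x y \<in> cball 1 (d / 4)"
        by (simp add: picard_def avg_def dist_norm norm_minus_commute \<rho>_def)
    qed
    fix w' :: "complex \<Rightarrow> complex \<Rightarrow> complex" and D :: real
    assume w': "continuous_on S (\<lambda>(x, y). w' x y)" "\<forall>(x, y)\<in>S. w' x y \<in> cball 1 (d / 4)"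
      and D: "\<forall>(x, y)\<in>S. norm (w x y - w' x y) \<le> D"
    have def_diff: "norm (deficit w x y - deficit w' x y) \<le> e * (CE / \<rho> * D)" if xy: "(x, y) \<in> S" for x y
    proof -
      have "norm (avg \<phi> k (\<lambda>x y. E x (w x y)) x y - avg \<phi> k (\<lambda>x y. E x (w' x y)) x y) \<le> CE / \<rho> * D"
      proof (rule norm_avg_diff_le [OF continuous_on_E [OF S' w] continuous_on_E [OF S' w'] S(2) k phi phi_le _ xy])
        fix x y assume xy: "(x, y) \<in> S"
        have "norm (E x (w x y) - E x (w' x y)) \<le> CE / \<rho> * norm (w x y - w' x y)"
          using w(2) w'(2) xy Sx [OF xy] e by (intro lipE) (auto simp: \<rho>_def)
        also have "\<dots> \<le> CE / \<rho> * D"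
          using D xy CE \<rho> by (intro mult_left_mono) auto
        finally show "norm (E x (w x y) - E x (w' x y)) \<le> CE / \<rho> * D" .
      qed
      then show ?thesis
        using Sx [OF xy] e(1) unfolding deficit_def right_diff_distrib [symmetric] norm_mult
        by (intro mult_mono) auto
    qed
    show "\<forall>(x, y)\<in>S. norm (picard w x y - picard w' x y) \<le> D / 2"
    proof clarify
      fix x y assume xy: "(x, y) \<in> S"
      show "norm (picard w x y - picard w' x y) \<le> D / 2"
        unfolding picard_def
      proof (rule norm_avg_diff_le [OF contFw [OF w w] contFw [OF w' w'] S(2) k _ _ _ xy])
        fix x y assume xy: "(x, y) \<in> S"
        let ?v = "deficit w x y" and ?v' = "deficit w' x y"
        have v: "norm ?v \<le> \<rho>" "norm ?v' \<le> \<rho>" and wb: "w x y \<in> cball 1 \<rho>" "w' x y \<in> cball 1 \<rho>"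
          using def_ball [OF w] w(2) def_ball [OF w'] w'(2) xy by (auto simp: \<rho>_def)
        have D': "norm (w x y - w' x y) \<le> D" using D xy by auto
        then have "0 \<le> D" using norm_ge_zero order.trans by blast
        \<comment> \<open>The arguments \<open>w\<close> and \<open>v\<close> are changed one at a
          time; each change costs at most \<open>D / 4\<close>.\<close>
        have "norm (F x y (w x y) ?v - F x y (w' x y) ?v) \<le> 1 / 4 * norm (w x y - w' x y)"
          using Sx [OF xy] e v wb by (intro lipw) auto
        moreover have "norm (F x y (w' x y) ?v - F x y (w' x y) ?v') \<le> CF / \<rho> * norm (?v - ?v')"
          using Sx [OF xy] e v wb by (intro lipv) auto
        moreover have "CF / \<rho> * norm (?v - ?v') \<le> CF / \<rho> * (e * (CE / \<rho> * D))"
          using def_diff [OF xy] CF \<rho> by (intro mult_left_mono) auto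
        moreover have "CF / \<rho> * (e * (CE / \<rho> * D)) \<le> 1 / 4 * D"
          using mult_right_mono [OF e(6) \<open>0 \<le> D\<close>] by (simp add: mult_ac)
        moreover have "norm (F x y (w x y) ?v - F x y (w' x y) ?v') \<le>
            norm (F x y (w x y) ?v - F x y (w' x y) ?v) + norm (F x y (w' x y) ?v - F x y (w' x y) ?v')"
          using norm_triangle_ineq [of "F x y (w x y) ?v - F x y (w' x y) ?v" "F x y (w' x y) ?v - F x y (w' x y) ?v'"]
          by simp
        ultimately show "norm (F x y (w x y) ?v - F x y (w' x y) ?v') \<le> D / 2"
          using D' by linarith
      qed (auto intro: continuous_intros)
    qed
  qed
  then show thesis by (rule that)
qed

lemma contraction_radiusD:
  assumes e: "contraction_radius e" and S: "S \<subseteq> ball 0 e \<times> ball 0 e" "star_like k S"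
    and w: "continuous_on S (\<lambda>(x, y). w x y)" "\<forall>(x, y)\<in>S. w x y \<in> cball 1 (d / 4)"
  shows "\<forall>(x, y)\<in>S. deficit w x y \<in> cball 0 (d / 4)"
    and "\<forall>(x, y)\<in>S. picard w x y \<in> cball 1 (d / 4)"
  using e [unfolded contraction_radius_def, THEN conjunct2, THEN conjunct2, THEN spec [of _ S], THEN spec [of _ w]]
    S w by blast+

lemma bihol_picard:
  assumes e: "contraction_radius e" and w: "bihol e w" "\<forall>(x, y)\<in>ball 0 e \<times> ball 0 e. w x y \<in> cball 1 (d / 4)"
  shows "bihol e (picard w)"
proof -
  have "e < d" using e by (simp add: contraction_radius_def)
  have S: "ball 0 e \<times> ball 0 e \<subseteq> ball (0::complex) d \<times> ball (0::complex) d"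
    using \<open>e < d\<close> by auto
  note sl = star_like_bidisc [OF k, of e]
  have wc: "continuous_on (ball 0 e \<times> ball 0 e) (\<lambda>(x, y). w x y)"
    using w by (simp add: bihol_def)
  have wb: "w x y \<in> ball 1 d" if "x \<in> ball 0 e" "y \<in> ball 0 e" for x y
  proof -
    have "w x y \<in> cball 1 (d / 4)" using w(2) that by blast
    then show ?thesis using d by simp
  qed
  have def_ball: "\<forall>(x, y)\<in>ball 0 e \<times> ball 0 e. deficit w x y \<in> cball 0 (d / 4)"
    by (rule contraction_radiusD(1) [OF e order.refl sl wc w(2)])
  then have db: "deficit w x y \<in> ball 0 d" if "x \<in> ball 0 e" "y \<in> ball 0 e" for x y
  proof -
    have "deficit w x y \<in> cball 0 (d / 4)" using def_ball that by blast
    then show ?thesis using d by simp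
  qed
  have in_d: "z \<in> ball 0 d" if "z \<in> ball 0 e" for z :: complex
    using that \<open>e < d\<close> by auto
  have "bihol e (\<lambda>x y. E x (w x y))"
    unfolding bihol_def
  proof (intro conjI ballI)
    show "continuous_on (ball 0 e \<times> ball 0 e) (\<lambda>(x, y). E x (w x y))"
      by (rule continuous_on_E [OF S wc w(2)])
    show "(\<lambda>x. E x (w x y)) holomorphic_on ball 0 e" if "y \<in> ball 0 e" for y
      using w(1) that wb in_d by (intro holE holomorphic_intros) (auto simp: bihol_def simp del: mem_ball)
    show "(\<lambda>y. E x (w x y)) holomorphic_on ball 0 e" if "x \<in> ball 0 e" for x
      using w(1) that wb in_d by (intro holE holomorphic_intros) (auto simp: bihol_def simp del: mem_ball)
  qed
  then have A: "bihol e (avg \<phi> k (\<lambda>x y. E x (w x y)))"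
    by (rule bihol_avg [OF _ k phi])
  have B: "bihol e (deficit w)"
    unfolding bihol_def deficit_def [abs_def]
    using A by (auto simp: bihol_def case_prod_unfold intro!: holomorphic_intros continuous_intros)
  have "bihol e (\<lambda>x y. F x y (w x y) (deficit w x y))"
    unfolding bihol_def
  proof (intro conjI ballI)
    show "continuous_on (ball 0 e \<times> ball 0 e) (\<lambda>(x, y). F x y (w x y) (deficit w x y))"
      by (rule continuous_on_F [OF S sl wc w(2) def_ball])
    show "(\<lambda>x. F x y (w x y) (deficit w x y)) holomorphic_on ball 0 e" if "y \<in> ball 0 e" for y
      using w(1) B that wb db in_d by (intro holF holomorphic_intros) (auto simp: bihol_def simp del: mem_ball)
    show "(\<lambda>y. F x y (w x y) (deficit w x y)) holomorphic_on ball 0 e" if "x \<in> ball 0 e" for x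
      using w(1) B that wb db in_d by (intro holF holomorphic_intros) (auto simp: bihol_def simp del: mem_ball)
  qed
  then show ?thesis
    unfolding picard_def by (rule bihol_avg [OF _ k]) (rule continuous_on_const)
qed

text \<open>Two sequences of iterates with possibly different starting points are compared. Choosing
  a shift of the first sequence as the second yields the Cauchy property, and choosing a constant
  sequence yields convergence to a given fixed point.\<close>

lemma picard_iterates_contract:
  assumes e: "contraction_radius e" and S: "S \<subseteq> ball 0 e \<times> ball 0 e" "star_like k S"
    and f: "\<And>n. continuous_on S (\<lambda>(x, y). f n x y)" "\<And>n. \<forall>(x, y)\<in>S. f n x y \<in> cball 1 (d / 4)"
      "\<And>n. \<forall>(x, y)\<in>S. f (Suc n) x y = picard (f n) x y"
    and g: "\<And>n. continuous_on S (\<lambda>(x, y). g n x y)" "\<And>n. \<forall>(x, y)\<in>S. g n x y \<in> cball 1 (d / 4)"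
      "\<And>n. \<forall>(x, y)\<in>S. g (Suc n) x y = picard (g n) x y"
  shows "\<forall>(x, y)\<in>S. norm (f n x y - g n x y) \<le> d / 2 ^ n"
proof (induction n)
  case 0
  show ?case
  proof clarify
    fix x y assume xy: "(x, y) \<in> S"
    have "dist 1 (f 0 x y) \<le> d / 4" "dist 1 (g 0 x y) \<le> d / 4"
      using f(2) [of 0] g(2) [of 0] xy by auto
    then have "dist (f 0 x y) (g 0 x y) \<le> d / 2"
      using dist_triangle3 [of "f 0 x y" "g 0 x y" 1] by simp
    then show "norm (f 0 x y - g 0 x y) \<le> d / 2 ^ 0"
      using d by (simp add: dist_norm)
  qed
next
  case (Suc n)
  have "\<forall>(x, y)\<in>S. norm (picard (f n) x y - picard (g n) x y) \<le> d / 2 ^ n / 2"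
    using e S f(1,2) [of n] g(1,2) [of n] Suc unfolding contraction_radius_def by blast
  then show ?case
    using f(3) [of n] g(3) [of n] by (force simp: mult.commute)
qed

text \<open>The iterates of the constant 1 converge on a complex bidisc to \<open>W\<close>. On the
  curve the same iterates converge to the given fixed point \<open>w\<close>, because the Picard map
  at a point of the curve uses only values on the curve. Uniqueness of limits gives the
  identification.\<close>

theorem solution_is_bihol:
  fixes w :: "real \<Rightarrow> complex"
  assumes w: "continuous_on {0..x0} w" "w 0 = 1" and "0 < x0"
    and sol: "\<And>x. x \<in> {0..x0} \<Longrightarrow>
      picard (\<lambda>x y. w (Re x)) (of_real x) (of_real (x powr k)) = w x"
  obtains e W x1 where "0 < e" "e < d" "bihol e W" "\<And>x y. x \<in> ball 0 e \<Longrightarrow> y \<in> ball 0 e \<Longrightarrow> W x y \<in> cball 1 (d / 4)"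
    "0 < x1" "x1 \<le> x0" "\<And>x. x \<in> {0..x1} \<Longrightarrow> x < e \<and> x powr k < e \<and> W (of_real x) (of_real (x powr k)) = w x"
proof -
  obtain e where e: "contraction_radius e" by (rule contraction_radius_exists)
  then have "0 < e" "e < d" by (auto simp: contraction_radius_def)
  let ?S = "ball (0::complex) e \<times> ball (0::complex) e"
  note sl = star_like_bidisc [OF k, of e]
  define f where "f n = (picard ^^ n) (\<lambda>_ _. 1)" for n
  have f_Suc: "f (Suc n) = picard (f n)" for n by (simp add: f_def)
  have f: "bihol e (f n) \<and> (\<forall>(x, y)\<in>?S. f n x y \<in> cball 1 (d / 4))" for n
  proof (induction n)
    case 0
    show ?case using d by (auto simp: f_def bihol_def case_prod_unfold)
  next
    case (Suc n)
    then have c: "continuous_on ?S (\<lambda>(x, y). f n x y)" by (simp add: bihol_def)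
    have "\<forall>(x, y)\<in>?S. picard (f n) x y \<in> cball 1 (d / 4)"
      using contraction_radiusD(2) [OF e order.refl sl c] Suc by blast
    with Suc show ?case unfolding f_Suc using bihol_picard [OF e] by blast
  qed
  have fc: "continuous_on ?S (\<lambda>(x, y). f n x y)" for n using f by (simp add: bihol_def)
  \<comment> \<open>The shifted sequence is again a sequence of Picard iterates, starting at
    \<open>f j\<close>.\<close>
  have cauchy: "norm (f (n + j) x y - f n x y) \<le> d / 2 ^ n" if "x \<in> ball 0 e" "y \<in> ball 0 e" for n j x y
    using picard_iterates_contract [OF e _ sl, of "\<lambda>n. f (n + j)" f n] fc f that
    by (auto simp: f_Suc simp del: mem_ball)
  have geom: "(\<lambda>n. d / 2 ^ n) \<longlonglongrightarrow> 0"
    by real_asymp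
  have "uniformly_Cauchy_on ?S (\<lambda>n (x, y). f n x y)"
  proof (rule uniformly_Cauchy_onI')
    fix \<epsilon> :: real assume "0 < \<epsilon>"
    then obtain N where N: "\<And>n. n \<ge> N \<Longrightarrow> d / 2 ^ n < \<epsilon>"
      using order_tendstoD(2) [OF geom] by (auto simp: eventually_sequentially)
    show "\<exists>M. \<forall>x\<in>?S. \<forall>m\<ge>M. \<forall>n>m. dist (case x of (x, y) \<Rightarrow> f m x y) (case x of (x, y) \<Rightarrow> f n x y) < \<epsilon>"
    proof (intro exI [of _ N] ballI allI impI)
      fix p m n assume p: "p \<in> ?S" and mn: "N \<le> m" "m < n"
      obtain x y where xy: "p = (x, y)" by (cases p)
      show "dist (case p of (x, y) \<Rightarrow> f m x y) (case p of (x, y) \<Rightarrow> f n x y) < \<epsilon>"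
        using cauchy [of x y m "n - m"] N [OF mn(1)] p mn
        by (simp add: xy dist_norm norm_minus_commute)
    qed
  qed
  then obtain W0 where W0: "uniform_limit ?S (\<lambda>n (x, y). f n x y) W0 sequentially"
    using Cauchy_uniformly_convergent uniformly_convergent_on_def by blast
  define W where "W x y = W0 (x, y)" for x y
  have ul: "uniform_limit ?S (\<lambda>n (x, y). f n x y) (\<lambda>(x, y). W x y) sequentially"
    using W0 by (simp add: W_def case_prod_unfold)
  have lim: "(\<lambda>n. f n x y) \<longlonglongrightarrow> W x y" if "x \<in> ball 0 e" "y \<in> ball 0 e" for x y
    using tendsto_uniform_limitI [OF ul, of "(x, y)"] that by simp
  have bW: "bihol e W"
    unfolding bihol_def
  proof (intro conjI ballI)
    show "continuous_on ?S (\<lambda>(x, y). W x y)"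
      by (rule uniform_limit_theorem [OF _ ul]) (use fc in auto)
    show "(\<lambda>x. W x y) holomorphic_on ball 0 e" if y: "y \<in> ball 0 e" for y
    proof (rule holomorphic_uniform_sequence [OF open_ball])
      show "(\<lambda>x. f n x y) holomorphic_on ball 0 e" for n using f y by (simp add: bihol_def)
      have "uniform_limit (ball 0 e) (\<lambda>n x. f n x y) (\<lambda>x. W x y) sequentially"
        using ul y by (auto simp: uniform_limit_iff elim!: eventually_mono all_forward)
      then show "\<exists>d>0. cball x d \<subseteq> ball 0 e \<and> uniform_limit (cball x d) (\<lambda>n x. f n x y) (\<lambda>x. W x y) sequentially"
        if "x \<in> ball 0 e" for x
        using open_contains_cball that uniform_limit_on_subset open_ball by metis
    qed
    show "(\<lambda>y. W x y) holomorphic_on ball 0 e" if x: "x \<in> ball 0 e" for x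
    proof (rule holomorphic_uniform_sequence [OF open_ball])
      show "(\<lambda>y. f n x y) holomorphic_on ball 0 e" for n using f x by (simp add: bihol_def)
      have "uniform_limit (ball 0 e) (\<lambda>n y. f n x y) (\<lambda>y. W x y) sequentially"
        using ul x by (auto simp: uniform_limit_iff elim!: eventually_mono all_forward)
      then show "\<exists>d>0. cball y d \<subseteq> ball 0 e \<and> uniform_limit (cball y d) (\<lambda>n y. f n x y) (\<lambda>y. W x y) sequentially"
        if "y \<in> ball 0 e" for y
        using open_contains_cball that uniform_limit_on_subset open_ball by metis
    qed
  qed
  have Wb: "W x y \<in> cball 1 (d / 4)" if "x \<in> ball 0 e" "y \<in> ball 0 e" for x y
    by (rule closed_sequentially [OF closed_cball _ lim [OF that]]) (use f that in blast)
  \<comment> \<open>The contraction estimate applies to \<open>w\<close> only where it is within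
    \<open>d / 4\<close> of 1, so the interval is shortened by continuity at 0.\<close>
  have "\<forall>\<^sub>F x in at_right 0. x < e \<and> x powr k < e \<and> norm (w x - 1) < d / 4"
  proof (intro eventually_conj)
    show "\<forall>\<^sub>F x in at_right 0. x < e" 
      using \<open>0 < e\<close> by (auto simp: eventually_at_right_field)
    have "((\<lambda>x. x powr k) \<longlongrightarrow> 0) (at_right 0)"
      using k by real_asymp
    then show "\<forall>\<^sub>F x in at_right 0. x powr k < e"
      using \<open>0 < e\<close> by (rule order_tendstoD)
    have "(w \<longlongrightarrow> w 0) (at_right 0)"
      using continuous_on_Icc_at_rightD [OF w(1) \<open>0 < x0\<close>] .
    then show "\<forall>\<^sub>F x in at_right 0. norm (w x - 1) < d / 4"
      using d w(2) unfolding tendsto_iff dist_norm by (metis divide_pos_pos zero_less_numeral)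
  qed
  then obtain b where "0 < b" and b: "\<And>x. 0 < x \<Longrightarrow> x < b \<Longrightarrow> x < e \<and> x powr k < e \<and> norm (w x - 1) < d / 4"
    by (auto simp: eventually_at_right_field)
  define x1 where "x1 = min (b / 2) x0"
  have x1: "0 < x1" "x1 \<le> x0" using \<open>0 < b\<close> \<open>0 < x0\<close> by (auto simp: x1_def)
  have small: "x < e" "x powr k < e" "w x \<in> cball 1 (d / 4)" if "x \<in> {0..x1}" for x
  proof -
    have "x < e \<and> x powr k < e \<and> norm (w x - 1) < d / 4"
    proof (cases "x = 0")
      case True
      then show ?thesis using \<open>0 < e\<close> d w(2) by simp
    next
      case False
      then show ?thesis using that \<open>0 < b\<close> by (intro b) (auto simp: x1_def)
    qed
    then show "x < e" "x powr k < e" "w x \<in> cball 1 (d / 4)"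
      by (auto simp: dist_norm norm_minus_commute)
  qed
  \<comment> \<open>A point of the curve is determined by its first coordinate, so
    \<open>w (Re x)\<close> represents the solution as a function of two complex variables on
    \<open>C\<close>.\<close>
  define C where "C = (\<lambda>x::real. (complex_of_real x, complex_of_real (x powr k))) ` {0..x1}"
  have C: "C \<subseteq> ?S" "star_like k C"
  proof -
    show "C \<subseteq> ?S" using small by (auto simp: C_def)
    show "star_like k C"
      unfolding star_like_def
    proof clarify
      fix a b :: complex and t :: real
      assume "(a, b) \<in> C" and t: "t \<in> {0..1}"
      then obtain x where x: "x \<in> {0..x1}" "a = of_real x" "b = of_real (x powr k)"
        by (auto simp: C_def)
      have "t * x \<in> {0..x1}"
        using x t mult_left_le_one_le [of x t] by auto
      moreover have "(t * x) powr k = t powr k * x powr k"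
        using x t by (simp add: powr_mult)
      ultimately show "(of_real t * a, of_real (t powr k) * b) \<in> C"
        unfolding C_def x by (intro image_eqI [of _ _ "t * x"]) auto
    qed
  qed
  have wC: "continuous_on C (\<lambda>(x, y). w (Re x))"
    unfolding case_prod_unfold
    by (rule continuous_on_compose2 [OF w(1)]) (use x1 in \<open>auto simp: C_def intro!: continuous_intros\<close>)
  have curve: "W (of_real x) (of_real (x powr k)) = w x" if x: "x \<in> {0..x1}" for x
  proof -
    have "norm (f n (of_real x) (of_real (x powr k)) - w x) \<le> d / 2 ^ n" for n
    proof -
      \<comment> \<open>The second sequence is constant: on \<open>C\<close> the solution equals its
        own image under \<open>picard\<close>.\<close>
      have "\<forall>(x, y)\<in>C. norm (f n x y - w (Re x)) \<le> d / 2 ^ n"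
      proof (rule picard_iterates_contract [OF e C, of f "\<lambda>_ x y. w (Re x)"])
        show "continuous_on C (\<lambda>(x, y). f n x y)" for n
          by (rule continuous_on_subset [OF fc C(1)])
        show "\<forall>(x, y)\<in>C. f n x y \<in> cball 1 (d / 4)" for n
          using f C(1) by blast
        show "\<forall>(x, y)\<in>C. w (Re x) \<in> cball 1 (d / 4)"
          using small by (auto simp: C_def)
        show "\<forall>(x, y)\<in>C. w (Re x) = picard (\<lambda>x y. w (Re x)) x y"
          using sol x1 by (auto simp: C_def)
      qed (use wC f_Suc in auto)
      then show ?thesis using x by (auto simp: C_def)
    qed
    then have "(\<lambda>n. f n (of_real x) (of_real (x powr k)) - w x) \<longlonglongrightarrow> 0"
      by (intro Lim_null_comparison [OF _ geom]) auto
    then have "(\<lambda>n. f n (of_real x) (of_real (x powr k))) \<longlonglongrightarrow> w x"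
      by (simp add: LIM_zero_iff)
    moreover have "(\<lambda>n. f n (of_real x) (of_real (x powr k))) \<longlonglongrightarrow> W (of_real x) (of_real (x powr k))"
      using small [OF x] x by (intro lim) auto
    ultimately show ?thesis using LIMSEQ_unique by blast
  qed
  show thesis
    by (rule that [OF \<open>0 < e\<close> \<open>e < d\<close> bW Wb x1]) (use small curve in auto)
qed

end

section \<open>Real analytic functions\<close>

text \<open>The same coefficients, read as complex numbers, have the same radius of
  convergence.\<close>

lemma has_fps_expansion_complexify:
  fixes f :: "real \<Rightarrow> real"
  assumes "f has_fps_expansion H"
  obtains r fc where "0 < r" "fc holomorphic_on ball 0 r"
    "\<And>x. \<bar>x\<bar> < r \<Longrightarrow> fc (of_real x) = complex_of_real (f x)"
proof -
  define Hc where "Hc = Abs_fps (\<lambda>n. complex_of_real (fps_nth H n))"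
  have rad: "fps_conv_radius Hc = fps_conv_radius H"
    using fps_conv_radius_norm [of Hc] fps_conv_radius_norm [of H] by (simp add: Hc_def)
  have "0 < fps_conv_radius H"
    using assms by (simp add: has_fps_expansion_def)
  then obtain r1 where r1: "0 < ereal r1" "ereal r1 < fps_conv_radius H"
    using ereal_dense2 by blast
  obtain r2 where r2: "0 < r2" "\<And>x. \<bar>x\<bar> < r2 \<Longrightarrow> eval_fps H x = f x"
    using assms by (auto simp: has_fps_expansion_def eventually_nhds_metric dist_norm)
  show thesis
  proof (rule that [of "min r1 r2" "eval_fps Hc"])
    show "0 < min r1 r2" using r1 r2 by simp
    show "eval_fps Hc holomorphic_on ball 0 (min r1 r2)"
    proof (rule holomorphic_on_eval_fps, rule subsetI)
      fix z :: complex assume "z \<in> ball 0 (min r1 r2)"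
      then have "ereal (norm z) < ereal r1" by simp
      with r1 show "z \<in> eball 0 (fps_conv_radius Hc)"
        by (simp add: rad del: ereal_less_eq less_ereal.simps)
    qed
    fix x :: real assume x: "\<bar>x\<bar> < min r1 r2"
    then have "ereal (norm x) < ereal r1" by simp
    with r1 have "ereal (norm x) < fps_conv_radius H" by (rule_tac less_trans)
    then have "(\<lambda>n. fps_nth H n * x ^ n) sums eval_fps H x"
      by (rule sums_eval_fps)
    then have "(\<lambda>n. complex_of_real (fps_nth H n * x ^ n)) sums of_real (eval_fps H x)"
      by (simp only: sums_of_real_iff)
    then have "eval_fps Hc (of_real x) = of_real (eval_fps H x)"
      by (simp add: eval_fps_def Hc_def sums_iff)
    then show "eval_fps Hc (of_real x) = complex_of_real (f x)"
      using r2 x by simp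
  qed
qed

lemma has_fps_expansion_imp_has_field_derivative:
  fixes f :: "'a :: {banach, real_normed_field} \<Rightarrow> 'a"
  assumes "f has_fps_expansion H"
  shows "\<forall>\<^sub>F x in nhds 0. (f has_field_derivative deriv f x) (at x)"
proof -
  have "\<forall>\<^sub>F z in nhds 0. z \<in> eball 0 (fps_conv_radius H)"
    using assms by (intro eventually_nhds_in_open) (auto simp: has_fps_expansion_def zero_ereal_def)
  \<comment> \<open>Agreement with the series near 0 entails agreement near every \<open>z\<close>
    close to 0, which is what transfers the derivative at \<open>z\<close>.\<close>
  moreover have "\<forall>\<^sub>F z in nhds 0. \<forall>\<^sub>F w in nhds z. eval_fps H w = f w"
    using assms by (subst eventually_eventually) (simp add: has_fps_expansion_def)
  ultimately show ?thesis
  proof eventually_elim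
    case (elim z)
    have "(eval_fps H has_field_derivative eval_fps (fps_deriv H) z) (at z)"
      using elim by (intro has_field_derivative_eval_fps) simp
    then have "(f has_field_derivative eval_fps (fps_deriv H) z) (at z)"
      using DERIV_cong_ev [OF refl elim(2) refl] by simp
    then show ?case by (simp add: DERIV_imp_deriv)
  qed
qed

text \<open>Termwise integration with one factor \<open>x\<close> split off: the coefficient of
  index n is divided by n + 1, which does not shrink the radius of convergence. The quotient u /
  \<eta> arises in this way.\<close>

lemma has_fps_expansion_primitive:
  fixes g :: "real \<Rightarrow> real"
  assumes "g has_fps_expansion H"
  obtains U J where "U has_fps_expansion J" "U 0 = g 0"
    "\<forall>\<^sub>F x in nhds 0. ((\<lambda>x. x * U x) has_real_derivative g x) (at x)"
proof -
  define J where "J = Abs_fps (\<lambda>n. fps_nth H n / real (Suc n))"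
  have rH: "0 < fps_conv_radius H" and ev: "\<forall>\<^sub>F z in nhds 0. eval_fps H z = g z"
    using assms by (auto simp: has_fps_expansion_def)
  have "conv_radius (fps_nth H) \<le> conv_radius (fps_nth J)"
  proof (rule conv_radius_geI_ex')
    fix r assume r: "0 < r" "ereal r < conv_radius (fps_nth H)"
    have "summable (\<lambda>n. norm (fps_nth H n * of_real r ^ n))"
      using r by (intro abs_summable_in_conv_radius) auto
    then show "summable (\<lambda>n. fps_nth J n * of_real r ^ n)"
      by (rule summable_comparison_test' [where N = 0])
         (use r in \<open>auto simp: J_def abs_mult divide_le_eq distrib_left\<close>)
  qed
  then have rJ: "0 < fps_conv_radius J"
    using rH by (simp add: fps_conv_radius_def)
  have eX: "(\<lambda>x. x * eval_fps J x) has_fps_expansion fps_X * J"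
    by (intro has_fps_expansion_mult has_fps_expansion_fps_X eval_fps_has_fps_expansion rJ)
  have "fps_deriv (fps_X * J) = H"
    by (rule fps_ext) (simp add: J_def del: fps_deriv_mult of_nat_Suc)
  then have "deriv (\<lambda>x. x * eval_fps J x) has_fps_expansion H"
    using has_fps_expansion_deriv [OF eX] by simp
  then have "\<forall>\<^sub>F x in nhds 0. eval_fps H x = deriv (\<lambda>x. x * eval_fps J x) x"
    by (simp add: has_fps_expansion_def)
  with ev has_fps_expansion_imp_has_field_derivative [OF eX]
  have "\<forall>\<^sub>F x in nhds 0. ((\<lambda>x. x * eval_fps J x) has_real_derivative g x) (at x)"
    by eventually_elim simp
  moreover have "eval_fps J 0 = g 0"
    using eventually_nhds_x_imp_x [OF ev] by (simp add: eval_fps_at_0 J_def)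
  ultimately show thesis
    by (intro that [of "eval_fps J" J] eval_fps_has_fps_expansion rJ)
qed

text \<open>The fundamental theorem of calculus on [0, x], rescaled to the unit interval as
  \<open>avg\<close> requires. The derivative is asked for only in the interior, since at 0, the
  stellar boundary, just continuity is at hand.\<close>

lemma increment_eq_integral:
  fixes f g :: "real \<Rightarrow> real"
  assumes f: "continuous_on {0..X} f" and g: "\<And>x. x \<in> {0<..<X} \<Longrightarrow> (f has_real_derivative g x) (at x)"
    and x: "x \<in> {0..X}"
  shows "((\<lambda>t. x * g (t * x)) has_integral (f x - f 0)) {0..1}"
proof (cases "x = 0")
  case False
  have "((\<lambda>t. x * g (t * x)) has_integral (f (1 * x) - f (0 * x))) {0..1}"
  proof (rule fundamental_theorem_of_calculus_interior)
    show "continuous_on {0..1} (\<lambda>t. f (t * x))"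
      using x by (intro continuous_on_compose2 [OF f] continuous_intros)
        (auto intro: order.trans [OF mult_left_le_one_le])
    fix t :: real assume t: "t \<in> {0<..<1}"
    have "0 < t * x" "t * x < 1 * x"
      using False x t by (auto intro: mult_strict_right_mono)
    then have "0 < t * x" "t * x < X"
      using x by auto
    then have "(f has_real_derivative g (t * x)) (at (t * x))"
      by (intro g) simp
    then have "((\<lambda>t. f (t * x)) has_real_derivative g (t * x) * x) (at t)"
      by (rule DERIV_chain2) (auto intro!: derivative_eq_intros)
    then show "((\<lambda>t. f (t * x)) has_vector_derivative x * g (t * x)) (at t)"
      by (simp add: has_real_derivative_iff_has_vector_derivative mult.commute)
  qed simp
  then show ?thesis by simp
qed auto

section \<open>The stellar boundary\<close>

text \<open>In terms of \<open>x = rp - r\<close>, the denominator \<open>r\<^sup>2 \<kappa>(r, m)\<close>, cleared of the pole at \<open>r = 0\<close>, and the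
  numerator \<open>Q(r, m, P)\<close>, whose last argument is \<open>p = P / c\<^sup>2\<close>.\<close>

definition tov_denom :: "real \<Rightarrow> real \<Rightarrow> real \<Rightarrow> real \<Rightarrow> 'a::real_normed_field \<Rightarrow> 'a \<Rightarrow> 'a" where
  "tov_denom c G \<Lambda> rp x m =
     (of_real rp - x)\<^sup>2 - of_real (2 * G / c\<^sup>2) * m * (of_real rp - x) - of_real (\<Lambda> / 3) * (of_real rp - x) ^ 4"

definition tov_numer :: "real \<Rightarrow> real \<Rightarrow> real \<Rightarrow> real \<Rightarrow> 'a::real_normed_field \<Rightarrow> 'a \<Rightarrow> 'a \<Rightarrow> 'a" where
  "tov_numer c G \<Lambda> rp x m p =
     of_real G * (m + of_real (4 * pi) * (of_real rp - x) ^ 3 * p) - of_real (c\<^sup>2 * \<Lambda> / 3) * (of_real rp - x) ^ 3"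

lemma of_real_tov_denom: "of_real (tov_denom c G \<Lambda> rp x m) = tov_denom c G \<Lambda> rp (of_real x) (of_real m)"
  by (simp add: tov_denom_def)

lemma of_real_tov_numer:
  "of_real (tov_numer c G \<Lambda> rp x m p) = tov_numer c G \<Lambda> rp (of_real x) (of_real m) (of_real p)"
  by (simp add: tov_numer_def)

text \<open>Here \<open>kk\<close> is the constant in \<rho> = kk \<eta>^\<nu>, \<open>mp\<close> is
  the limit mass, and \<open>\<beta>\<close> is the limit of d\<eta>/dx at x = 0. The real functions
  \<open>K\<close> and \<open>Om\<close> come with holomorphic extensions on a common disc.\<close>

locale boundary_ivp =
  fixes K Om :: "real \<Rightarrow> real" and Kc Omc :: "complex \<Rightarrow> complex"
    and r c G \<Lambda> rp mp kk \<nu> \<beta> :: real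
  assumes r: "0 < r" and c_nz: "c \<noteq> 0" and holK: "Kc holomorphic_on ball 0 r" and holOm: "Omc holomorphic_on ball 0 r"
    and Kc_real: "\<And>x. \<bar>x\<bar> < r \<Longrightarrow> Kc (of_real x) = of_real (K x)"
    and Omc_real: "\<And>x. \<bar>x\<bar> < r \<Longrightarrow> Omc (of_real x) = of_real (Om x)"
    and pos: "0 < \<nu>" "0 < kk" "0 < \<beta>"
    and denom0: "tov_denom c G \<Lambda> rp 0 mp \<noteq> 0"
    and beta: "\<beta> = K 0 * tov_numer c G \<Lambda> rp 0 mp 0 / tov_denom c G \<Lambda> rp 0 mp"
begin

text \<open>The right-hand side of the equation for \<eta>, divided by \<beta>, after the
  substitution \<eta> = \<beta> x w. In the pressure, \<eta>^(\<nu> + 1) has become \<beta>^(\<nu> +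
  1) y w^(\<nu> + 1), with the principal branch near w = 1.\<close>

definition F :: "complex \<Rightarrow> complex \<Rightarrow> complex \<Rightarrow> complex \<Rightarrow> complex" where
  "F x y w v = Kc (of_real \<beta> * x * w) *
     tov_numer c G \<Lambda> rp x (of_real mp - v)
       (of_real (kk * \<beta> powr (\<nu> + 1)) * y * w powr of_real (\<nu> + 1) * Omc (of_real \<beta> * x * w)) /
     (of_real \<beta> * tov_denom c G \<Lambda> rp x (of_real mp - v))"

text \<open>This is 4 pi r^2 \<rho> without its factor x^\<nu>. That factor, taken at t x, combines
  with the x of the rescaled integral to y t^\<nu>, which accounts for the weight and the prefactor
  in \<open>deficit\<close>.\<close>

definition E :: "complex \<Rightarrow> complex \<Rightarrow> complex" where
  "E x w = of_real (4 * pi * kk * \<beta> powr \<nu>) * (of_real rp - x)\<^sup>2 * w powr of_real \<nu>"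

text \<open>The bound 1/2 keeps \<open>w\<close> in the right half-plane and its norm below 2; then
  \<open>2 * \<beta> * d \<le> r\<close> keeps \<beta> x w in the disc where \<open>Kc\<close> and
  \<open>Omc\<close> are holomorphic.\<close>

lemma ivp_radius_exists:
  obtains d where "0 < d" "d \<le> 1 / 2" "2 * \<beta> * d \<le> r"
    "\<And>x v :: complex. x \<in> ball 0 d \<Longrightarrow> v \<in> ball 0 d \<Longrightarrow> tov_denom c G \<Lambda> rp x (of_real mp - v) \<noteq> 0"
proof -
  let ?f = "\<lambda>p::complex \<times> complex. tov_denom c G \<Lambda> rp (fst p) (of_real mp - snd p)"
  have "open (?f -` (- {0}))"
    by (rule open_vimage) (use c_nz in \<open>auto simp: tov_denom_def intro!: continuous_intros\<close>)
  moreover have "(0, 0) \<in> ?f -` (- {0})"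
    using denom0 of_real_tov_denom [of c G \<Lambda> rp 0 mp, where 'a = complex] by auto
  ultimately obtain A B where AB: "open A" "open B" "(0, 0) \<in> A \<times> B" "A \<times> B \<subseteq> ?f -` (- {0})"
    by (rule open_prod_elim)
  then obtain a b where ab: "0 < a" "ball 0 a \<subseteq> A" "0 < b" "ball 0 b \<subseteq> B"
    by (meson SigmaE2 open_contains_ball)
  define d where "d = min (min (1 / 2) (r / (2 * \<beta>))) (min a b)"
  show thesis
  proof (rule that [of d])
    show "0 < d" "d \<le> 1 / 2" using ab r pos by (auto simp: d_def)
    have "d \<le> r / (2 * \<beta>)" by (simp add: d_def)
    then show "2 * \<beta> * d \<le> r" using pos by (simp add: field_simps)
    show "tov_denom c G \<Lambda> rp x (of_real mp - v) \<noteq> 0" if "x \<in> ball 0 d" "v \<in> ball 0 d" for x v :: complex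
    proof -
      have "(x, v) \<in> A \<times> B" using ab that by (auto simp: d_def)
      then show ?thesis using AB(4) by auto
    qed
  qed
qed

lemma scaled_in_ball_r:
  assumes "d \<le> 1 / 2" "2 * \<beta> * d \<le> r" "x \<in> ball 0 d" "w \<in> ball 1 d"
  shows "of_real \<beta> * x * w \<in> ball (0::complex) r"
proof -
  have "norm w \<le> 1 + norm (w - 1)" using norm_triangle_ineq [of 1 "w - 1"] by simp
  then have w: "norm w \<le> 2" using assms by (simp add: dist_norm norm_minus_commute)
  have "norm (of_real \<beta> * x * w) \<le> \<beta> * norm x * 2"
    using pos w by (simp add: norm_mult mult_left_mono)
  also have "\<dots> < \<beta> * d * 2"
    using assms pos by simp
  finally show ?thesis using assms by simp
qed

lemma not_nonpos_Reals:
  assumes "d \<le> 1 / 2" "w \<in> ball 1 d"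
  shows "0 < Re w" "w \<notin> \<real>\<^sub>\<le>\<^sub>0"
proof -
  have "\<bar>Re (1 - w)\<bar> < d" using abs_Re_le_cmod [of "1 - w"] assms by (simp add: dist_norm)
  then show "0 < Re w" using assms by auto
  then show "w \<notin> \<real>\<^sub>\<le>\<^sub>0" by (auto simp: complex_nonpos_Reals_iff)
qed

lemma singular_ivp_F_E:
  assumes d: "0 < d" "d \<le> 1 / 2" "2 * \<beta> * d \<le> r"
    and denom: "\<And>x v :: complex. x \<in> ball 0 d \<Longrightarrow> v \<in> ball 0 d \<Longrightarrow> tov_denom c G \<Lambda> rp x (of_real mp - v) \<noteq> 0"
  shows "singular_ivp F E (\<lambda>t. t powr \<nu>) (\<nu> + 1) d"
proof
  show "0 < d" "0 < \<nu> + 1" using d pos by auto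
  show "continuous_on {0..1} (\<lambda>t. t powr \<nu>)" by (rule continuous_on_powr_unit) (rule pos)
  show "\<bar>t powr \<nu>\<bar> \<le> 1" if "t \<in> {0..1}" for t using that pos by (intro powr_unit_le_one) auto
  note inr = scaled_in_ball_r [OF d(2,3)] and nnp = not_nonpos_Reals [OF d(2)]
  note cont = continuous_on_compose2 [OF holomorphic_on_imp_continuous_on]
  let ?S = "ball (0::complex) d \<times> ball (0::complex) d \<times> ball (1::complex) d \<times> ball (0::complex) d"
  have arg: "continuous_on ?S (\<lambda>p. of_real \<beta> * fst p * fst (snd (snd p)))"
    by (intro continuous_intros)
  have arg_in: "(\<lambda>p. of_real \<beta> * fst p * fst (snd (snd p))) ` ?S \<subseteq> ball 0 r"
    by (rule image_subsetI, rule inr) auto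
  have cK: "continuous_on ?S (\<lambda>p. Kc (of_real \<beta> * fst p * fst (snd (snd p))))"
    and cOm: "continuous_on ?S (\<lambda>p. Omc (of_real \<beta> * fst p * fst (snd (snd p))))"
    by (rule cont [OF holK arg arg_in] cont [OF holOm arg arg_in])+
  have cw: "continuous_on ?S (\<lambda>p. fst (snd (snd p)) powr of_real (\<nu> + 1))"
  proof (intro continuous_intros)
    show "?S \<subseteq> {z. 0 \<le> Re (fst (snd (snd z))) \<or> Im (fst (snd (snd z))) \<noteq> 0}"
    proof
      fix z assume "z \<in> ?S"
      then have "fst (snd (snd z)) \<in> ball 1 d" by auto
      then show "z \<in> {z. 0 \<le> Re (fst (snd (snd z))) \<or> Im (fst (snd (snd z))) \<noteq> 0}"
        using nnp(1) by (simp add: less_imp_le)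
    qed
  qed (use pos in auto)
  have cd: "continuous_on ?S (\<lambda>p. tov_denom c G \<Lambda> rp (fst p) (of_real mp - snd (snd (snd p))))"
    unfolding tov_denom_def by (intro continuous_intros)
  have nz: "\<forall>p\<in>?S. of_real \<beta> * tov_denom c G \<Lambda> rp (fst p) (of_real mp - snd (snd (snd p))) \<noteq> 0"
    using denom pos by (auto simp del: mem_ball)
  have "continuous_on ?S (\<lambda>p. F (fst p) (fst (snd p)) (fst (snd (snd p))) (snd (snd (snd p))))"
    unfolding F_def tov_numer_def
    by (rule continuous_on_divide [OF _ _ nz]; intro continuous_intros cK cOm cw cd)
  then show "continuous_on ?S (\<lambda>(x, y, w, v). F x y w v)"
    by (simp add: case_prod_unfold)
  have "continuous_on (ball 0 d \<times> ball 1 d) (\<lambda>p. E (fst p) (snd p))"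
  proof -
    have "continuous_on (ball 0 d \<times> ball 1 d) (\<lambda>p::complex \<times> complex. snd p powr of_real \<nu>)"
    proof (intro continuous_intros)
      show "ball 0 d \<times> ball 1 d \<subseteq> {z::complex \<times> complex. 0 \<le> Re (snd z) \<or> Im (snd z) \<noteq> 0}"
      proof
        fix z :: "complex \<times> complex" assume "z \<in> ball 0 d \<times> ball 1 d"
        then have "snd z \<in> ball 1 d" by auto
        then show "z \<in> {z. 0 \<le> Re (snd z) \<or> Im (snd z) \<noteq> 0}"
          using nnp(1) by (simp add: less_imp_le)
      qed
    qed (use pos in auto)
    then show ?thesis
      unfolding E_def by (rule continuous_on_mult [rotated]; intro continuous_intros)
  qed
  then show "continuous_on (ball 0 d \<times> ball 1 d) (\<lambda>(x, w). E x w)"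
    by (simp add: case_prod_unfold)
  show "(\<lambda>z. F (a z) (b z) (w z) (v z)) holomorphic_on S"
    if h: "open S" "a holomorphic_on S" "b holomorphic_on S" "w holomorphic_on S" "v holomorphic_on S"
      "\<And>z. z \<in> S \<Longrightarrow> a z \<in> ball 0 d \<and> b z \<in> ball 0 d \<and> w z \<in> ball 1 d \<and> v z \<in> ball 0 d" for S a b w v
  proof -
    have "(\<lambda>z. of_real \<beta> * a z * w z) holomorphic_on S"
      by (intro holomorphic_intros h)
    then have "(Kc \<circ> (\<lambda>z. of_real \<beta> * a z * w z)) holomorphic_on S" "(Omc \<circ> (\<lambda>z. of_real \<beta> * a z * w z)) holomorphic_on S"
      using h(6) inr holK holOm by (auto intro!: holomorphic_on_compose_gen simp del: mem_ball)
    then have "(\<lambda>z. Kc (of_real \<beta> * a z * w z)) holomorphic_on S" "(\<lambda>z. Omc (of_real \<beta> * a z * w z)) holomorphic_on S"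
      by (simp_all add: o_def)
    moreover have "(\<lambda>z. tov_denom c G \<Lambda> rp (a z) (of_real mp - v z)) holomorphic_on S"
      unfolding tov_denom_def by (intro holomorphic_intros h)
    ultimately show ?thesis
      unfolding F_def tov_numer_def
      by (intro holomorphic_intros h(1-5)) (use h(6) nnp denom pos in \<open>auto simp del: mem_ball\<close>)
  qed
  show "(\<lambda>z. E (a z) (w z)) holomorphic_on S"
    if h: "open S" "a holomorphic_on S" "w holomorphic_on S" "\<And>z. z \<in> S \<Longrightarrow> a z \<in> ball 0 d \<and> w z \<in> ball 1 d" for S a w
    unfolding E_def by (intro holomorphic_intros h(1-3)) (use h(4) nnp in blast)
  \<comment> \<open>In \<open>F\<close> the variable \<open>w\<close> occurs only multiplied by
    \<open>x\<close> or by \<open>y\<close>.\<close>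
  show "F 0 0 w v = F 0 0 1 v" for w v
    by (simp add: F_def)
  have "tov_numer c G \<Lambda> rp (0::complex) (of_real mp) 0 = of_real (tov_numer c G \<Lambda> rp 0 mp 0)"
       "tov_denom c G \<Lambda> rp (0::complex) (of_real mp) = of_real (tov_denom c G \<Lambda> rp 0 mp)"
    by (simp_all add: of_real_tov_numer of_real_tov_denom)
  then have "F 0 0 1 0 = of_real (K 0 * tov_numer c G \<Lambda> rp 0 mp 0 / tov_denom c G \<Lambda> rp 0 mp / \<beta>)"
    using Kc_real [of 0] r by (simp add: F_def)
  also have "\<dots> = 1"
    unfolding beta [symmetric] using pos by simp
  finally show "F 0 0 1 0 = 1" .
qed

lemma continuous_on_real_restriction:
  assumes "fc holomorphic_on ball 0 r" "\<And>x. \<bar>x\<bar> < r \<Longrightarrow> fc (of_real x) = complex_of_real (f x)"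
  shows "continuous_on {-r<..<r} f"
proof -
  have "continuous_on {-r<..<r} (\<lambda>x. fc (of_real x))"
    by (rule continuous_on_compose2 [OF holomorphic_on_imp_continuous_on [OF assms(1)] continuous_on_of_real_id])
       (simp add: image_subset_iff abs_less_iff minus_less_iff)
  then have "continuous_on {-r<..<r} (\<lambda>x. Re (fc (of_real x)))"
    by (rule continuous_on_Re)
  then show ?thesis
    by (rule continuous_on_eq) (simp add: assms(2) abs_less_iff minus_less_iff)
qed

text \<open>The pair (e, M) is the solution (\<eta>, m) in the variable x = rp - r. Integration from
  0 to x turns its two differential equations into the fixed point problem of
  \<open>singular_ivp\<close> along y = x^(\<nu> + 1).\<close>

theorem boundary_expansion:
  fixes e M :: "real \<Rightarrow> real"
  defines "R \<equiv> \<lambda>x. K (e x) * tov_numer c G \<Lambda> rp x (M x) (kk * e x powr (\<nu> + 1) * Om (e x)) /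
    tov_denom c G \<Lambda> rp x (M x)"
  assumes "0 < X" and conte: "continuous_on {0..X} e" and contM: "continuous_on {0..X} M"
    and init: "e 0 = 0" "M 0 = mp"
    and e_pos: "\<And>x. x \<in> {0<..X} \<Longrightarrow> 0 < e x" and e_less: "\<And>x. x \<in> {0..X} \<Longrightarrow> e x < r"
    and denom: "\<And>x. x \<in> {0..X} \<Longrightarrow> tov_denom c G \<Lambda> rp x (M x) \<noteq> 0"
    and de: "\<And>x. x \<in> {0<..<X} \<Longrightarrow> (e has_real_derivative R x) (at x)"
    and dM: "\<And>x. x \<in> {0<..<X} \<Longrightarrow>
      (M has_real_derivative - (4 * pi * (rp - x)\<^sup>2 * (kk * e x powr \<nu>))) (at x)"
  obtains \<delta> W x1 where "0 < \<delta>" "bihol \<delta> W" "W 0 0 = 1"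
    "\<And>x y. x \<in> ball 0 \<delta> \<Longrightarrow> y \<in> ball 0 \<delta> \<Longrightarrow> 0 < Re (W x y) \<and> of_real \<beta> * x * W x y \<in> ball 0 r"
    "0 < x1" "x1 \<le> X" "\<And>x. x \<in> {0..x1} \<Longrightarrow> x < \<delta> \<and> x powr (\<nu> + 1) < \<delta> \<and>
       (\<exists>w>0. W (of_real x) (of_real (x powr (\<nu> + 1))) = of_real w \<and> e x = \<beta> * x * w)"
proof -
  obtain d where dd: "0 < d" "d \<le> 1 / 2" "2 * \<beta> * d \<le> r"
    "\<And>x v :: complex. x \<in> ball 0 d \<Longrightarrow> v \<in> ball 0 d \<Longrightarrow> tov_denom c G \<Lambda> rp x (of_real mp - v) \<noteq> 0"
    by (rule ivp_radius_exists, rule that)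
  interpret singular_ivp F E "\<lambda>t. t powr \<nu>" "\<nu> + 1" d
    by (rule singular_ivp_F_E [OF dd])
  have e_abs: "\<bar>e x\<bar> < r" if "x \<in> {0..X}" for x
    using e_pos [of x] e_less [of x] that init by (cases "x = 0") auto
  have contpw: "continuous_on {0..X} (\<lambda>x. e x powr a)" if "0 < a" for a
  proof (rule continuous_on_powr' [OF conte continuous_on_const])
    show "\<forall>x\<in>{0..X}. 0 \<le> e x \<and> (e x = 0 \<longrightarrow> 0 < a)"
    proof
      fix x assume "x \<in> {0..X}"
      then show "0 \<le> e x \<and> (e x = 0 \<longrightarrow> 0 < a)"
        using e_pos [of x] init that by (cases "x = 0") auto
    qed
  qed
  have contR: "continuous_on {0..X} R"
  proof -
    have img: "e ` {0..X} \<subseteq> {-r<..<r}"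
      using e_abs by (auto simp: abs_less_iff minus_less_iff)
    have K: "continuous_on {-r<..<r} K" and Om: "continuous_on {-r<..<r} Om"
      by (rule continuous_on_real_restriction [OF holK], rule Kc_real, assumption)
         (rule continuous_on_real_restriction [OF holOm], rule Omc_real, assumption)
    have "continuous_on {0..X} (\<lambda>x. K (e x))" "continuous_on {0..X} (\<lambda>x. Om (e x))"
      using continuous_on_compose2 [OF K conte img] continuous_on_compose2 [OF Om conte img] .
    moreover have "continuous_on {0..X} (\<lambda>x. e x powr (\<nu> + 1))"
      using pos by (intro contpw) auto
    moreover have "continuous_on {0..X} (\<lambda>x. tov_denom c G \<Lambda> rp x (M x))"
      unfolding tov_denom_def by (intro continuous_intros contM)
    ultimately show ?thesis
      unfolding R_def tov_numer_def using denom
      by (intro continuous_on_divide continuous_on_mult continuous_on_diff continuous_on_add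
            continuous_on_const continuous_on_power continuous_on_id contM) auto
  qed
  have tx: "t * x \<in> {0..X}" if "t \<in> {0..1}" "x \<in> {0..X}" for t x :: real
    using that mult_left_le_one_le [of x t] by auto
  \<comment> \<open>The mean of the derivative replaces the quotient
    \<open>e x / (\<beta> * x)\<close>; it agrees with it for x > 0 and is also continuous at 0,
    where it equals R(0) / \<beta> = 1.\<close>
  define w where "w x = integral {0..1} (\<lambda>t. R (t * x)) / \<beta>" for x
  have intR: "(\<lambda>t. R (t * x)) integrable_on {0..1}" if "x \<in> {0..X}" for x
    by (intro integrable_continuous_real continuous_on_compose2 [OF contR] continuous_intros) (use tx that in auto)
  have ew: "e x = \<beta> * x * w x" if x: "x \<in> {0..X}" for x
  proof -
    have "((\<lambda>t. x * R (t * x)) has_integral (e x - e 0)) {0..1}"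
      by (rule increment_eq_integral [OF conte de x])
    moreover have "((\<lambda>t. x * R (t * x)) has_integral (x * integral {0..1} (\<lambda>t. R (t * x)))) {0..1}"
      by (intro has_integral_mult_right integrable_integral intR x)
    ultimately have "e x - e 0 = x * integral {0..1} (\<lambda>t. R (t * x))"
      by (rule has_integral_unique)
    then show ?thesis
      using init pos by (simp add: w_def)
  qed
  have contw: "continuous_on {0..X} w"
  proof -
    have "continuous_on ({0..X} \<times> cbox 0 1) (\<lambda>p. R (snd p * fst p))"
      by (intro continuous_on_compose2 [OF contR] continuous_intros) (use tx in auto)
    then have "continuous_on {0..X} (\<lambda>x. integral (cbox 0 1) (\<lambda>t. R (t * x)))"
      by (intro integral_continuous_on_param) (simp add: case_prod_unfold)
    then show ?thesis
      unfolding w_def using pos by (auto intro!: continuous_intros)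
  qed
  have "R 0 = \<beta>"
    by (subst beta) (simp add: R_def init)
  then have w0: "w 0 = 1"
    using pos by (simp add: w_def)
  have w_pos: "0 < w x" if x: "x \<in> {0..X}" for x
  proof (cases "x = 0")
    case False
    then have "0 < \<beta> * x * w x"
      using e_pos [of x] x unfolding ew [OF x, symmetric] by simp
    then show ?thesis
      by (rule zero_less_mult_pos) (use False x pos in simp)
  qed (use w0 in simp)
  have e_powr: "e x powr a = \<beta> powr a * x powr a * w x powr a" if "x \<in> {0..X}" for x a
    using ew [OF that] w_pos [OF that] that pos by (simp add: powr_mult)
  let ?w = "\<lambda>(x::complex) (y::complex). complex_of_real (w (Re x))"
  have deficit_eq: "deficit ?w (of_real x) (of_real (x powr (\<nu> + 1))) = of_real (mp - M x)"
    if x: "x \<in> {0..X}" for x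
  proof -
    let ?g = "\<lambda>x. - (4 * pi * (rp - x)\<^sup>2 * (kk * e x powr \<nu>))"
    have "((\<lambda>t. x * ?g (t * x)) has_integral (M x - M 0)) {0..1}"
      by (rule increment_eq_integral [OF contM dM x])
    then have "((\<lambda>t. - (x * ?g (t * x))) has_integral - (M x - M 0)) {0..1}"
      by (rule has_integral_neg)
    then have "((\<lambda>t. complex_of_real (- (x * ?g (t * x)))) has_integral of_real (mp - M x)) {0..1}"
      using init by (intro has_integral_of_real) simp
    \<comment> \<open>Both sides contain x^(\<nu> + 1) t^\<nu> = x (t x)^\<nu>, and (t x)^\<nu> is
      the factor of \<rho> that \<open>E\<close> omits.\<close>
    moreover have "of_real (x powr (\<nu> + 1)) * (of_real (t powr \<nu>) * E (of_real t * of_real x) (?w (of_real t * of_real x) y)) =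
        complex_of_real (- (x * ?g (t * x)))" if t: "t \<in> {0..1}" for t :: real and y :: complex
    proof -
      have "E (of_real t * of_real x) (?w (of_real t * of_real x) y) =
          of_real (4 * pi * kk * \<beta> powr \<nu> * (rp - t * x)\<^sup>2 * w (t * x) powr \<nu>)"
        using w_pos [OF tx [OF t x]] by (simp add: E_def powr_of_real less_imp_le)
      then show ?thesis
        using e_powr [OF tx [OF t x], of \<nu>] x t pos
        by (simp add: powr_mult powr_add mult_ac flip: of_real_mult)
    qed
    ultimately have "((\<lambda>t. of_real (x powr (\<nu> + 1)) * (of_real (t powr \<nu>) *
        E (of_real t * of_real x) (?w (of_real t * of_real x) (of_real (t powr (\<nu> + 1)) * of_real (x powr (\<nu> + 1))))))
        has_integral of_real (mp - M x)) {0..1}"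
      by (subst has_integral_cong) auto
    then show ?thesis
      unfolding deficit_def avg_def
      by (subst integral_mult_right [symmetric]) (rule integral_unique)
  qed
  have F_eq: "F (of_real x) (of_real (x powr (\<nu> + 1))) (of_real (w x)) (of_real (mp - M x)) = of_real (R x / \<beta>)"
    if x: "x \<in> {0..X}" for x
  proof -
    have arg: "of_real \<beta> * of_real x * of_real (w x) = complex_of_real (e x)"
      using ew [OF x] by simp
    have p: "of_real (kk * \<beta> powr (\<nu> + 1)) * of_real (x powr (\<nu> + 1)) * of_real (w x) powr of_real (\<nu> + 1) * of_real (Om (e x)) =
        complex_of_real (kk * e x powr (\<nu> + 1) * Om (e x))"
      using w_pos [OF x] e_powr [OF x, of "\<nu> + 1"] by (simp add: powr_of_real less_imp_le del: of_real_add)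
    have m: "of_real mp - of_real (mp - M x) = complex_of_real (M x)" by simp
    show ?thesis
      unfolding F_def arg Kc_real [OF e_abs [OF x]] Omc_real [OF e_abs [OF x]] p m
      by (simp add: R_def of_real_tov_numer of_real_tov_denom)
  qed
  have sol: "picard ?w (of_real x) (of_real (x powr (\<nu> + 1))) = of_real (w x)" if x: "x \<in> {0..X}" for x
  proof -
    have "((\<lambda>t. R (t * x) / \<beta>) has_integral w x) {0..1}"
      unfolding w_def by (rule has_integral_divide [OF integrable_integral [OF intR [OF x]]])
    then have int: "((\<lambda>t. complex_of_real (R (t * x) / \<beta>)) has_integral of_real (w x)) {0..1}"
      by (rule has_integral_of_real)
    have F: "F (of_real t * of_real x) (of_real (t powr (\<nu> + 1)) * of_real (x powr (\<nu> + 1)))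
        (?w (of_real t * of_real x) (of_real (t powr (\<nu> + 1)) * of_real (x powr (\<nu> + 1))))
        (deficit ?w (of_real t * of_real x) (of_real (t powr (\<nu> + 1)) * of_real (x powr (\<nu> + 1)))) =
        complex_of_real (R (t * x) / \<beta>)" if t: "t \<in> {0..1}" for t
    proof -
      \<comment> \<open>The dilated point is the point of the curve with parameter
        \<open>t * x\<close>, so the identities for \<open>deficit\<close> and \<open>F\<close>
        apply there.\<close>
      have "of_real (t powr (\<nu> + 1)) * of_real (x powr (\<nu> + 1)) = complex_of_real ((t * x) powr (\<nu> + 1))"
        using t x by (simp add: powr_mult)
      moreover have "of_real t * of_real x = complex_of_real (t * x)" by simp
      ultimately show ?thesis
        using deficit_eq [OF tx [OF t x]] F_eq [OF tx [OF t x]] by (simp only: Re_complex_of_real)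
    qed
    show ?thesis
      unfolding picard_def avg_def
      by (rule integral_unique, rule has_integral_eq [OF _ int]) (simp only: F of_real_1 mult_1)
  qed
  have cw: "continuous_on {0..X} (\<lambda>x. complex_of_real (w x))" and cw0: "complex_of_real (w 0) = 1"
    using w0 by (auto intro!: continuous_intros contw)
  obtain \<delta> W x1 where W: "0 < \<delta>" "\<delta> < d" "bihol \<delta> W"
    "\<And>x y. x \<in> ball 0 \<delta> \<Longrightarrow> y \<in> ball 0 \<delta> \<Longrightarrow> W x y \<in> cball 1 (d / 4)"
    "0 < x1" "x1 \<le> X" "\<And>x. x \<in> {0..x1} \<Longrightarrow> x < \<delta> \<and> x powr (\<nu> + 1) < \<delta> \<and>
      W (of_real x) (of_real (x powr (\<nu> + 1))) = of_real (w x)"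
    by (rule solution_is_bihol [OF cw cw0 \<open>0 < X\<close> sol], assumption, rule that)
  show thesis
  proof (rule that [OF W(1,3)])
    show "W 0 0 = 1"
      using W(7) [of 0] W(5) w0 by simp
    show "0 < Re (W x y) \<and> of_real \<beta> * x * W x y \<in> ball 0 r" if "x \<in> ball 0 \<delta>" "y \<in> ball 0 \<delta>" for x y
    proof -
      have "W x y \<in> ball 1 d" using W(4) [OF that] dd by auto
      then show ?thesis
        using not_nonpos_Reals(1) [OF dd(2)] scaled_in_ball_r [OF dd(2,3), of x] that W(2) by auto
    qed
    show "x < \<delta> \<and> x powr (\<nu> + 1) < \<delta> \<and>
       (\<exists>w>0. W (of_real x) (of_real (x powr (\<nu> + 1))) = of_real w \<and> e x = \<beta> * x * w)" if x: "x \<in> {0..x1}" for x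
    proof (intro conjI exI [of _ "w x"])
      have "x \<in> {0..X}" using x W(6) by simp
      then show "0 < w x" "e x = \<beta> * x * w x" by (rule w_pos, rule ew)
    qed (use W(7) [OF x] in simp_all)
  qed (rule W(5), rule W(6))
qed

end

section \<open>The equation of state\<close>

text \<open>In du/d\<eta> = (dP/d\<rho>) / ((\<rho> + P/c^2) d\<eta>/d\<rho>) all fractional powers
  of \<rho> cancel, which leaves a quotient of functions analytic at \<eta> = 0. \<open>K\<close> is
  its reciprocal and \<open>\<eta> * U \<eta>\<close> its primitive.\<close>

lemma eos_expansion:
  fixes eos \<Omega> :: "real \<Rightarrow> real"
  assumes "0 < c" "0 < A" "1 < \<gamma>" and H: "\<Omega> has_fps_expansion H" and "\<Omega> 0 = 1"
    and eos: "\<And>s. 0 < s \<Longrightarrow> eos s = A * s powr \<gamma> * \<Omega> (A * s powr (\<gamma> - 1) / c\<^sup>2)"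
    and \<eta>_def: "\<eta> = (\<lambda>s. A * s powr (\<gamma> - 1) / c\<^sup>2)"
  obtains K KH U UH s0 where "K has_fps_expansion KH" "U has_fps_expansion UH"
    "K 0 = (\<gamma> - 1) / (c\<^sup>2 * \<gamma>)" "U 0 = 1 / K 0" "0 < s0"
    "\<And>s. 0 < s \<Longrightarrow> s < s0 \<Longrightarrow> (\<gamma> - 1) * \<eta> s / s * (s + eos s / c\<^sup>2) = K (\<eta> s) * deriv eos s"
    "\<And>s. 0 < s \<Longrightarrow> s < s0 \<Longrightarrow> u_of_density c eos s = \<eta> s * U (\<eta> s)"
proof -
  \<comment> \<open>Since P = c^2 s \<eta> \<Omega>(\<eta>) and s d\<eta>/ds = (\<gamma> - 1)
    \<eta>, one has dP/ds = c^2 \<eta> N(\<eta>) and s + P/c^2 = s D(\<eta>). The values N(0) =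
    \<gamma> and D(0) = 1 give K(0).\<close>
  define N where "N x = \<gamma> * \<Omega> x + (\<gamma> - 1) * x * deriv \<Omega> x" for x
  define D where "D x = 1 + x * \<Omega> x" for x
  define NH where "NH = fps_const \<gamma> * H + fps_const (\<gamma> - 1) * fps_X * fps_deriv H"
  define DH where "DH = 1 + fps_X * H"
  have N: "N has_fps_expansion NH"
    unfolding N_def [abs_def] NH_def
    by (intro has_fps_expansion_add has_fps_expansion_mult has_fps_expansion_const
        has_fps_expansion_fps_X has_fps_expansion_deriv H)
  have D: "D has_fps_expansion DH"
    unfolding D_def [abs_def] DH_def
    by (intro has_fps_expansion_add has_fps_expansion_mult has_fps_expansion_1
        has_fps_expansion_fps_X H)
  have N0: "N 0 = \<gamma>" and D0: "D 0 = 1"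
    using \<open>\<Omega> 0 = 1\<close> by (simp_all add: N_def D_def)
  have nth0: "fps_nth G 0 = f 0" if "f has_fps_expansion G" for f :: "real \<Rightarrow> real" and G
    using that by (auto simp: has_fps_expansion_def eval_fps_at_0 dest: eventually_nhds_x_imp_x)
  have K: "(\<lambda>x. (\<gamma> - 1) / c\<^sup>2 * (D x / N x)) has_fps_expansion fps_const ((\<gamma> - 1) / c\<^sup>2) * (DH / NH)"
    using nth0 [OF N] N0 \<open>1 < \<gamma>\<close>
    by (intro has_fps_expansion_mult has_fps_expansion_const has_fps_expansion_divide' D N) auto
  have g: "(\<lambda>x. c\<^sup>2 / (\<gamma> - 1) * (N x / D x)) has_fps_expansion fps_const (c\<^sup>2 / (\<gamma> - 1)) * (NH / DH)"
    using nth0 [OF D] D0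
    by (intro has_fps_expansion_mult has_fps_expansion_const has_fps_expansion_divide' D N) auto
  obtain U UH where U: "U has_fps_expansion UH" "U 0 = c\<^sup>2 / (\<gamma> - 1) * (N 0 / D 0)"
    and U': "\<forall>\<^sub>F x in nhds 0. ((\<lambda>x. x * U x) has_real_derivative c\<^sup>2 / (\<gamma> - 1) * (N x / D x)) (at x)"
    by (rule has_fps_expansion_primitive [OF g], rule that)
  have "\<forall>\<^sub>F x in nhds 0. N x \<noteq> 0" "\<forall>\<^sub>F x in nhds 0. D x \<noteq> 0"
    using has_fps_expansion_imp_continuous [OF N, of UNIV] has_fps_expansion_imp_continuous [OF D, of UNIV] N0 D0 \<open>1 < \<gamma>\<close>
    by (auto simp: continuous_at_imp_continuous_at_within isCont_def tendsto_imp_eventually_ne eventually_nhds_conv_at)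
  with U' has_fps_expansion_imp_has_field_derivative [OF H]
  have "\<forall>\<^sub>F x in nhds 0. (\<Omega> has_real_derivative deriv \<Omega> x) (at x) \<and> N x \<noteq> 0 \<and> D x \<noteq> 0 \<and>
      ((\<lambda>x. x * U x) has_real_derivative c\<^sup>2 / (\<gamma> - 1) * (N x / D x)) (at x)"
    by eventually_elim simp
  then obtain r where "0 < r" and r: "\<And>x. \<bar>x\<bar> < r \<Longrightarrow> (\<Omega> has_real_derivative deriv \<Omega> x) (at x) \<and> N x \<noteq> 0 \<and> D x \<noteq> 0 \<and>
      ((\<lambda>x. x * U x) has_real_derivative c\<^sup>2 / (\<gamma> - 1) * (N x / D x)) (at x)"
    by (auto simp: eventually_nhds_metric dist_norm)
  have "(\<eta> \<longlongrightarrow> 0) (at_right 0)"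
    unfolding \<eta>_def using \<open>1 < \<gamma>\<close> \<open>0 < c\<close> by real_asymp
  then have "\<forall>\<^sub>F s in at_right 0. \<eta> s < r"
    using \<open>0 < r\<close> by (rule order_tendstoD)
  then obtain s0 where "0 < s0" and s0: "\<And>s. 0 < s \<Longrightarrow> s < s0 \<Longrightarrow> \<eta> s < r"
    by (auto simp: eventually_at_right_field)
  have \<eta>_pos: "0 < \<eta> s" if "0 < s" for s
    using that \<open>0 < A\<close> \<open>0 < c\<close> by (simp add: \<eta>_def)
  have \<eta>_abs: "\<bar>\<eta> s\<bar> < r" if "0 < s" "s < s0" for s
    using s0 [OF that] \<eta>_pos [OF that(1)] by simp
  have \<eta>_deriv: "(\<eta> has_real_derivative (\<gamma> - 1) * \<eta> s / s) (at s)" if "0 < s" for s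
  proof -
    have "(\<eta> has_real_derivative A * ((\<gamma> - 1) * s powr (\<gamma> - 1 - 1)) / c\<^sup>2) (at s)"
      unfolding \<eta>_def by (intro DERIV_cdivide DERIV_cmult has_real_derivative_powr that)
    also have "s powr (\<gamma> - 1 - 1) = s powr (\<gamma> - 1) / s"
      using that by (subst powr_diff) simp
    also have "A * ((\<gamma> - 1) * (s powr (\<gamma> - 1) / s)) / c\<^sup>2 = (\<gamma> - 1) * \<eta> s / s"
      by (simp add: \<eta>_def mult_ac)
    finally show ?thesis .
  qed
  have eos': "eos s = c\<^sup>2 * s * \<eta> s * \<Omega> (\<eta> s)" if "0 < s" for s
    using eos [OF that] that \<open>0 < c\<close> by (simp add: \<eta>_def powr_diff)
  have deriv_eos: "deriv eos s = c\<^sup>2 * \<eta> s * N (\<eta> s)" if s: "0 < s" "s < s0" for s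
  proof (rule DERIV_imp_deriv)
    have "((\<lambda>s. \<Omega> (\<eta> s)) has_real_derivative deriv \<Omega> (\<eta> s) * ((\<gamma> - 1) * \<eta> s / s)) (at s)"
      using r [OF \<eta>_abs [OF s]] \<eta>_deriv [OF s(1)] by (intro DERIV_chain2) auto
    then have "((\<lambda>s. c\<^sup>2 * s * \<eta> s * \<Omega> (\<eta> s)) has_real_derivative c\<^sup>2 * \<eta> s * N (\<eta> s)) (at s)"
      using \<eta>_deriv [OF s(1)] s by (auto intro!: derivative_eq_intros simp: N_def field_simps)
    then show "(eos has_real_derivative c\<^sup>2 * \<eta> s * N (\<eta> s)) (at s)"
      by (rule has_field_derivative_transform_within_open [of _ _ _ "{0<..}"]) (use s eos' in auto)
  qed
  have sum_eos: "s + eos s / c\<^sup>2 = s * D (\<eta> s)" if "0 < s" for s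
    using eos' [OF that] \<open>0 < c\<close> by (simp add: D_def field_simps)
  show thesis
  proof (rule that [OF K U(1) _ _ \<open>0 < s0\<close>])
    show "(\<gamma> - 1) / c\<^sup>2 * (D 0 / N 0) = (\<gamma> - 1) / (c\<^sup>2 * \<gamma>)"
      by (simp add: N0 D0)
    show "U 0 = 1 / ((\<gamma> - 1) / c\<^sup>2 * (D 0 / N 0))"
      by (simp add: U(2) N0 D0)
    show "(\<gamma> - 1) * \<eta> s / s * (s + eos s / c\<^sup>2) =
        (\<gamma> - 1) / c\<^sup>2 * (D (\<eta> s) / N (\<eta> s)) * deriv eos s" if s: "0 < s" "s < s0" for s
      using r [OF \<eta>_abs [OF s]] s \<open>0 < c\<close> by (simp add: deriv_eos [OF s] sum_eos [OF s(1)])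
    show "u_of_density c eos s = \<eta> s * U (\<eta> s)" if s: "0 < s" "s < s0" for s
    proof -
      \<comment> \<open>The integrand may blow up at t = 0, but the primitive is continuous there,
        with value 0 because \<open>\<eta> 0\<close> is 0; a derivative in the interior
        suffices.\<close>
      have "((\<lambda>t. deriv eos t / (t + eos t / c\<^sup>2)) has_integral (\<eta> s * U (\<eta> s) - \<eta> 0 * U (\<eta> 0))) {0..s}"
      proof (rule fundamental_theorem_of_calculus_interior)
        have \<eta>_cont: "continuous_on {0..s} \<eta>"
          unfolding \<eta>_def using \<open>1 < \<gamma>\<close> \<open>0 < c\<close> by (intro continuous_intros continuous_on_powr') auto
        have "continuous_on {-r<..<r} (\<lambda>x. x * U x)"
          using r by (intro DERIV_continuous_on [where D = "\<lambda>x. c\<^sup>2 / (\<gamma> - 1) * (N x / D x)"])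
            (auto simp: abs_less_iff minus_less_iff intro: has_field_derivative_at_within)
        moreover have "\<eta> ` {0..s} \<subseteq> {-r<..<r}"
        proof (rule image_subsetI)
          fix t assume t: "t \<in> {0..s}"
          show "\<eta> t \<in> {-r<..<r}"
          proof (cases "t = 0")
            case True
            then show ?thesis using \<open>0 < r\<close> by (simp add: \<eta>_def)
          next
            case False
            then have "\<bar>\<eta> t\<bar> < r" using t s by (intro \<eta>_abs) auto
            then show ?thesis by (simp add: abs_less_iff minus_less_iff)
          qed
        qed
        ultimately show "continuous_on {0..s} (\<lambda>t. \<eta> t * U (\<eta> t))"
          using continuous_on_compose2 [OF _ \<eta>_cont] by blast
        fix t assume t: "t \<in> {0<..<s}"
        then have t': "0 < t" "t < s0" using s by auto
        have "((\<lambda>t. \<eta> t * U (\<eta> t)) has_real_derivative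
            c\<^sup>2 / (\<gamma> - 1) * (N (\<eta> t) / D (\<eta> t)) * ((\<gamma> - 1) * \<eta> t / t)) (at t)"
          using r [OF \<eta>_abs [OF t']] \<eta>_deriv [OF t'(1)] by (intro DERIV_chain2 [of "\<lambda>x. x * U x" _ \<eta>]) auto
        also have "c\<^sup>2 / (\<gamma> - 1) * (N (\<eta> t) / D (\<eta> t)) * ((\<gamma> - 1) * \<eta> t / t) = deriv eos t / (t + eos t / c\<^sup>2)"
          using \<open>1 < \<gamma>\<close> t' by (simp add: deriv_eos [OF t'] sum_eos [OF t'(1)] mult_ac)
        finally show "((\<lambda>t. \<eta> t * U (\<eta> t)) has_vector_derivative deriv eos t / (t + eos t / c\<^sup>2)) (at t)"
          by (simp add: has_real_derivative_iff_has_vector_derivative)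
      qed (use s in simp)
      then show ?thesis
        unfolding u_of_density_def by (intro integral_unique) (simp add: \<eta>_def)
    qed
  qed
qed

lemma eos_strict_mono:
  fixes eos :: "real \<Rightarrow> real"
  assumes "\<forall>s>0. eos differentiable (at s)" "\<forall>s>0. 0 < deriv eos s" "0 < s" "s < t"
  shows "eos s < eos t"
proof (rule DERIV_pos_imp_increasing [OF \<open>s < t\<close>])
  fix x assume "s \<le> x" "x \<le> t"
  then show "\<exists>y. (eos has_real_derivative y) (at x) \<and> 0 < y"
    using assms by (intro exI [of _ "deriv eos x"]) (auto simp: DERIV_deriv_iff_real_differentiable)
qed

lemma density_of_pressure_eos:
  fixes eos :: "real \<Rightarrow> real"
  assumes "\<forall>s>0. eos differentiable (at s)" "\<forall>s>0. 0 < deriv eos s" "0 < s"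
  shows "density_of_pressure eos (eos s) = s"
  unfolding density_of_pressure_def
proof (rule the_inv_into_f_f)
  show "inj_on eos {0<..}"
  proof (rule linorder_inj_onI)
    show "eos x \<noteq> eos y" if "x < y" "x \<in> {0<..}" "y \<in> {0<..}" for x y
      using eos_strict_mono [OF assms(1,2), of x y] that by auto
  qed auto
qed (use assms in auto)

text \<open>The range of \<open>eos\<close> may be bounded, so the inverse function rule is applied
  locally, on the image of the bracket from s/2 to 2 s, which the intermediate value theorem shows
  to be filled.\<close>

lemma density_of_pressure_deriv:
  fixes eos :: "real \<Rightarrow> real"
  assumes diff: "\<forall>s>0. eos differentiable (at s)" and pos: "\<forall>s>0. 0 < deriv eos s" and s: "0 < s"
  shows "(density_of_pressure eos has_real_derivative inverse (deriv eos s)) (at (eos s))"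
proof (rule DERIV_inverse_function [where f = eos and a = "eos (s / 2)" and b = "eos (2 * s)"])
  note inv = density_of_pressure_eos [OF diff pos]
  have cont: "isCont eos z" if "0 < z" for z
    using diff that by (auto intro: differentiable_imp_continuous_within)
  show "(eos has_real_derivative deriv eos s) (at (density_of_pressure eos (eos s)))"
    using diff s inv [OF s] by (simp add: DERIV_deriv_iff_real_differentiable)
  show "deriv eos s \<noteq> 0" using pos s by force
  show "eos (s / 2) < eos s" "eos s < eos (2 * s)"
    using s by (intro eos_strict_mono [OF diff pos]; simp)+
  show "eos (density_of_pressure eos y) = y" if "eos (s / 2) < y" "y < eos (2 * s)" for y
  proof -
    have "\<exists>z\<ge>s / 2. z \<le> 2 * s \<and> eos z = y"
      using that s cont by (intro IVT) auto
    then obtain z where "s / 2 \<le> z" "eos z = y" by blast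
    then show ?thesis using inv [of z] s by auto
  qed
  show "isCont (density_of_pressure eos) (eos s)"
  proof (rule isCont_inverse_function2 [of "s / 2" s "2 * s"])
    show "density_of_pressure eos (eos z) = z" if "s / 2 \<le> z" "z \<le> 2 * s" for z
      by (rule inv) (use that s in simp)
    show "isCont eos z" if "s / 2 \<le> z" "z \<le> 2 * s" for z
      by (rule cont) (use that s in simp)
  qed (use s in auto)
qed

section \<open>Monotone-short solutions\<close>

lemma tendsto_at_left_bounded_mono:
  fixes f :: "real \<Rightarrow> real"
  assumes "a < b" and mono: "\<And>x y. a < x \<Longrightarrow> x \<le> y \<Longrightarrow> y < b \<Longrightarrow> f x \<le> f y"
    and bound: "\<And>x. a < x \<Longrightarrow> x < b \<Longrightarrow> f x \<le> C"
  obtains l where "(f \<longlongrightarrow> l) (at_left b)"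
proof
  have bdd: "bdd_above (f ` {a<..<b})"
    using bound by (intro bdd_aboveI [of _ C]) auto
  show "(f \<longlongrightarrow> Sup (f ` {a<..<b})) (at_left b)"
  proof (rule increasing_tendsto)
    show "\<forall>\<^sub>F x in at_left b. f x \<le> Sup (f ` {a<..<b})"
      using eventually_at_left_real [OF \<open>a < b\<close>] by eventually_elim (auto intro!: cSup_upper bdd)
    fix l assume "l < Sup (f ` {a<..<b})"
    then obtain x where x: "a < x" "x < b" "l < f x"
      using less_cSup_iff [OF _ bdd, of l] \<open>a < b\<close> by auto
    have "\<forall>\<^sub>F y in at_left b. y \<in> {x<..<b}"
      by (rule eventually_at_left_real [OF \<open>x < b\<close>])
    then show "\<forall>\<^sub>F y in at_left b. l < f y"
    proof eventually_elim
      case (elim y)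
      then have "f x \<le> f y" using x by (intro mono) auto
      then show ?case using x by simp
    qed
  qed
qed

text \<open>The left limit at \<open>rp\<close> becomes the value at x = 0, which yields continuity
  on the closed interval and derivatives strictly inside. The sign of the derivative changes with
  the orientation.\<close>

lemma reflected_boundary:
  fixes f :: "real \<Rightarrow> real"
  assumes lim: "(f \<longlongrightarrow> l) (at_left rp)" and f: "\<forall>r\<in>{0<..<rp}. (f has_real_derivative f' r) (at r)"
    and X: "0 < X" "X < rp"
  defines "g \<equiv> \<lambda>x. if x \<le> 0 then l else f (rp - x)"
  shows "\<And>x. x \<in> {0<..<rp} \<Longrightarrow> (g has_real_derivative - f' (rp - x)) (at x)" "continuous_on {0..X} g"
proof -
  show der: "(g has_real_derivative - f' (rp - x)) (at x)" if x: "x \<in> {0<..<rp}" for x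
  proof -
    have "((\<lambda>x. f (rp - x)) has_real_derivative f' (rp - x) * - 1) (at x)"
      by (rule DERIV_chain2 [OF bspec [OF f]]) (use x in \<open>auto intro!: derivative_eq_intros\<close>)
    then show ?thesis
      by (rule has_field_derivative_transform_within_open [of _ _ _ "{0<..}", OF _ open_greaterThan, THEN DERIV_cong])
         (use x in \<open>auto simp: g_def\<close>)
  qed
  have "filterlim (\<lambda>x. rp - x) (at_left rp) (at_right 0)"
    by (auto simp: filterlim_at eventually_at_filter intro!: tendsto_eq_intros)
  then have "((\<lambda>x. f (rp - x)) \<longlongrightarrow> l) (at_right 0)"
    by (rule filterlim_compose [OF lim])
  moreover have "\<forall>\<^sub>F x in at_right 0. f (rp - x) = g x"
    by (auto simp: g_def eventually_at_filter)
  ultimately have "(g \<longlongrightarrow> g 0) (at_right 0)"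
    using filterlim_cong [OF refl refl] by (force simp: g_def elim: Lim_transform_eventually)
  then show "continuous_on {0..X} g"
  proof (rule continuous_on_IccI)
    show "(g \<longlongrightarrow> g x) (at x)" if "0 < x" "x < X" for x
      using DERIV_isCont [OF der, of x] that X by (simp add: isCont_def)
    have "(g \<longlongrightarrow> g X) (at X)"
      using DERIV_isCont [OF der, of X] X by (simp add: isCont_def)
    then show "(g \<longlongrightarrow> g X) (at_left X)"
      by (rule tendsto_within_subset) simp
  qed (use X in auto)
qed

theorem theorem4:
  fixes c G \<Lambda> A \<gamma> rp B :: real
    and \<Omega> eos m P \<rho> u :: "real \<Rightarrow> real"
  assumes "0 < c" "0 < G" "0 < \<Lambda>"
    and "\<And>s. 0 < s \<Longrightarrow> 0 < eos s"
    and "\<And>s. 0 < s \<Longrightarrow> eos differentiable (at s)"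
    and "\<And>s. 0 < s \<Longrightarrow> 0 < deriv eos s \<and> deriv eos s < c\<^sup>2"
    and "(eos \<longlongrightarrow> 0) (at_right 0)"
    and "0 < A" "1 < \<gamma>" "\<gamma> < 2"
    and "real_analytic_near \<Omega> {0..}" "\<Omega> 0 = 1"
    and "\<And>s. 0 < s \<Longrightarrow> eos s = A * s powr \<gamma> * \<Omega> (A * s powr (\<gamma> - 1) / c\<^sup>2)"
    and "monotone_short c G \<Lambda> eos rp m P"
    and "\<And>r. r \<in> {0<..<rp} \<Longrightarrow> \<rho> r = density_of_pressure eos (P r)"
    and "\<And>r. r \<in> {0<..<rp} \<Longrightarrow> u r = u_of_density c eos (\<rho> r)"
    and "B = Q_plus c G \<Lambda> rp m P / (rp\<^sup>2 * kappa_plus c G \<Lambda> rp m)"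
  shows "(\<exists>a. dps_convergent a \<and>
            (\<forall>\<^sub>F r in at_left rp.
               u r = B * (rp - r)
                 * (1 + dps_eval a (rp - r) ((rp - r) powr (\<gamma> / (\<gamma> - 1)))))) \<and>
         (\<exists>b. dps_convergent b \<and>
            (\<forall>\<^sub>F r in at_left rp.
               \<rho> r = ((\<gamma> - 1) * B / (\<gamma> * A)) powr (1 / (\<gamma> - 1))
                 * (rp - r) powr (1 / (\<gamma> - 1))
                 * (1 + dps_eval b (rp - r) ((rp - r) powr (\<gamma> / (\<gamma> - 1))))))"
proof -
  note c = assms(1) and eos_pos = assms(4) and A = assms(8) and \<gamma> = assms(9,10)
    and \<Omega>0 = assms(12) and eos = assms(13) and \<rho>_def = assms(15) and u_def = assms(16) and B = assms(17)
  have diff: "\<forall>s>0. eos differentiable (at s)" and dpos: "\<forall>s>0. 0 < deriv eos s"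
    using assms(5,6) by blast+
  have rp: "0 < rp" and sol: "tov_solution c G \<Lambda> eos rp m P" and P0: "(P \<longlongrightarrow> 0) (at_left rp)"
    and kQ: "0 < kappa_plus c G \<Lambda> rp m" "0 < Q_plus c G \<Lambda> rp m P"
    using assms(14) by (auto simp: monotone_short_def)
  define \<nu> where "\<nu> = 1 / (\<gamma> - 1)"
  have \<nu>: "0 < \<nu>" "(\<gamma> - 1) * \<nu> = 1" "\<gamma> / (\<gamma> - 1) = \<nu> + 1"
    using \<gamma> by (auto simp: \<nu>_def field_simps)
  obtain H where H: "\<Omega> has_fps_expansion H"
    using assms(11) by (force simp: real_analytic_near_def)
  define \<eta> where "\<eta> = (\<lambda>s. A * s powr (\<gamma> - 1) / c\<^sup>2)"
  obtain K KH U UH s0 where KH: "K has_fps_expansion KH" and UH: "U has_fps_expansion UH"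
    and K0: "K 0 = (\<gamma> - 1) / (c\<^sup>2 * \<gamma>)" and U0: "U 0 = 1 / K 0" and "0 < s0"
    and K_eq: "\<And>s. 0 < s \<Longrightarrow> s < s0 \<Longrightarrow> (\<gamma> - 1) * \<eta> s / s * (s + eos s / c\<^sup>2) = K (\<eta> s) * deriv eos s"
    and U_eq: "\<And>s. 0 < s \<Longrightarrow> s < s0 \<Longrightarrow> u_of_density c eos s = \<eta> s * U (\<eta> s)"
    by (rule eos_expansion [OF c A \<gamma>(1) H \<Omega>0 eos \<eta>_def], assumption, rule that)
  obtain rK Kc where rK: "0 < rK" "Kc holomorphic_on ball 0 rK" "\<And>x. \<bar>x\<bar> < rK \<Longrightarrow> Kc (of_real x) = complex_of_real (K x)"
    by (rule has_fps_expansion_complexify [OF KH], rule that)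
  obtain rU Uc where rU: "0 < rU" "Uc holomorphic_on ball 0 rU" "\<And>x. \<bar>x\<bar> < rU \<Longrightarrow> Uc (of_real x) = complex_of_real (U x)"
    by (rule has_fps_expansion_complexify [OF UH], rule that)
  obtain rO Omc where rO: "0 < rO" "Omc holomorphic_on ball 0 rO" "\<And>x. \<bar>x\<bar> < rO \<Longrightarrow> Omc (of_real x) = complex_of_real (\<Omega> x)"
    by (rule has_fps_expansion_complexify [OF H], rule that)
  define r0 where "r0 = min rK (min rU rO)"
  have r0: "0 < r0" "r0 \<le> rK" "r0 \<le> rU" "r0 \<le> rO" using rK rU rO by (auto simp: r0_def)

  \<comment> \<open>Limits of the density and the mass at the boundary\<close>
  have sol': "P r \<in> eos ` {0<..}" "0 < kappa c G \<Lambda> r (m r)"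
    "(m has_real_derivative 4 * pi * r\<^sup>2 * \<rho> r) (at r)"
    "(P has_real_derivative - (\<rho> r + P r / c\<^sup>2) * (Qfun c G \<Lambda> r (m r) (P r) / (r\<^sup>2 * kappa c G \<Lambda> r (m r)))) (at r)"
    if "r \<in> {0<..<rp}" for r
    using sol that \<rho>_def [OF that] by (auto simp: tov_solution_def tov_domain_def)
  have \<rho>: "0 < \<rho> r" "eos (\<rho> r) = P r" if r: "r \<in> {0<..<rp}" for r
  proof -
    obtain s where "0 < s" "P r = eos s" using sol'(1) [OF r] by auto
    then show "0 < \<rho> r" "eos (\<rho> r) = P r"
      using density_of_pressure_eos [OF diff dpos, of s] \<rho>_def [OF r] by auto
  qed
  have near: "\<forall>\<^sub>F r in at_left rp. r \<in> {0<..<rp}"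
    by (rule eventually_at_left_real [OF rp])
  have \<rho>_lim: "(\<rho> \<longlongrightarrow> 0) (at_left rp)"
  proof (rule decreasing_tendsto)
    show "\<forall>\<^sub>F r in at_left rp. 0 \<le> \<rho> r"
      using near by eventually_elim (use \<rho> in \<open>auto intro: less_imp_le\<close>)
    fix a :: real assume "0 < a"
    then have "\<forall>\<^sub>F r in at_left rp. P r < eos a"
      by (intro order_tendstoD(2) [OF P0] eos_pos)
    with near show "\<forall>\<^sub>F r in at_left rp. \<rho> r < a"
    proof eventually_elim
      case (elim r)
      show ?case
      proof (rule ccontr)
        assume "\<not> \<rho> r < a"
        then have "eos a \<le> eos (\<rho> r)"
          using eos_strict_mono [OF diff dpos \<open>0 < a\<close>, of "\<rho> r"] by (cases "a = \<rho> r") auto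
        then show False using elim \<rho>(2) [OF elim(1)] by simp
      qed
    qed
  qed
  have m_mono: "m x \<le> m y" if "0 < x" "x \<le> y" "y < rp" for x y
    by (rule DERIV_nonneg_imp_nondecreasing [OF \<open>x \<le> y\<close>])
       (use that sol'(3) \<rho>(1) in \<open>force intro!: mult_nonneg_nonneg less_imp_le\<close>)
  \<comment> \<open>Dropping the nonnegative \<Lambda> term from \<kappa> > 0 leaves 2 G m < c^2
    r.\<close>
  have m_bound: "m r \<le> c\<^sup>2 * rp / (2 * G)" if r: "0 < r" "r < rp" for r
  proof -
    have "0 < 1 - 2 * G * m r / (c\<^sup>2 * r) - \<Lambda> / 3 * r\<^sup>2"
      using sol'(2) [of r] r by (simp add: kappa_def)
    moreover have "0 \<le> \<Lambda> / 3 * r\<^sup>2" using assms(3) by simp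
    ultimately have "2 * G * m r / (c\<^sup>2 * r) < 1" by linarith
    then have "2 * G * m r < c\<^sup>2 * r" using c r by (simp add: divide_less_eq)
    also have "\<dots> \<le> c\<^sup>2 * rp" using r by (intro mult_left_mono) auto
    finally show ?thesis using assms(2) by (simp add: field_simps)
  qed
  obtain mp where mp: "(m \<longlongrightarrow> mp) (at_left rp)"
    by (rule tendsto_at_left_bounded_mono [OF rp, of m], erule (2) m_mono, erule (1) m_bound, rule that)
  \<comment> \<open>The definitions use \<open>Lim\<close>, whose value is known only because the
    limit \<open>mp\<close> has now been shown to exist.\<close>
  have kp: "kappa_plus c G \<Lambda> rp m = kappa c G \<Lambda> rp mp"
    unfolding kappa_plus_def kappa_def
    by (rule tendsto_Lim) (use rp c in \<open>auto intro!: tendsto_intros mp\<close>)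
  have Qp: "Q_plus c G \<Lambda> rp m P = Qfun c G \<Lambda> rp mp 0"
    unfolding Q_plus_def Qfun_def
    by (rule tendsto_Lim; (intro tendsto_intros mp P0)?) (use c in auto)

  \<comment> \<open>The equation for \<eta>, reflected to x = rp - r\<close>
  define q where "q r = Qfun c G \<Lambda> r (m r) (P r) / (r\<^sup>2 * kappa c G \<Lambda> r (m r))" for r
  \<comment> \<open>The function \<open>q\<close> is -du/dr, and \<open>B\<close> is its limit at
    the boundary. By the chain rule d\<eta>/dr is \<open>q\<close> times the negative of an
    expression that equals K(\<eta>) at small densities.\<close>
  have eta_deriv: "\<forall>r\<in>{0<..<rp}. ((\<lambda>r. \<eta> (\<rho> r)) has_real_derivative
      - ((\<gamma> - 1) * \<eta> (\<rho> r) / \<rho> r * (\<rho> r + eos (\<rho> r) / c\<^sup>2) / deriv eos (\<rho> r) * q r)) (at r)"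
  proof
    fix r assume r: "r \<in> {0<..<rp}"
    have "((\<lambda>r. density_of_pressure eos (P r)) has_real_derivative
        inverse (deriv eos (\<rho> r)) * (- (\<rho> r + P r / c\<^sup>2) * q r)) (at r)"
      using density_of_pressure_deriv [OF diff dpos \<rho>(1) [OF r]] sol'(4) [OF r] unfolding \<rho>(2) [OF r] q_def
      by (rule DERIV_chain2)
    then have "(\<rho> has_real_derivative inverse (deriv eos (\<rho> r)) * (- (\<rho> r + P r / c\<^sup>2) * q r)) (at r)"
      by (rule has_field_derivative_transform_within_open [of _ _ _ "{0<..<rp}"]) (use r \<rho>_def in auto)
    with has_real_derivative_powr [OF \<rho>(1) [OF r]]
    have "((\<lambda>r. \<rho> r powr (\<gamma> - 1)) has_real_derivative (\<gamma> - 1) * \<rho> r powr (\<gamma> - 1 - 1) *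
        (inverse (deriv eos (\<rho> r)) * (- (\<rho> r + P r / c\<^sup>2) * q r))) (at r)"
      by (rule DERIV_chain2)
    then have "((\<lambda>r. \<eta> (\<rho> r)) has_real_derivative A * ((\<gamma> - 1) * \<rho> r powr (\<gamma> - 1 - 1) *
        (inverse (deriv eos (\<rho> r)) * (- (\<rho> r + P r / c\<^sup>2) * q r))) / c\<^sup>2) (at r)"
      unfolding \<eta>_def by (intro DERIV_cdivide DERIV_cmult)
    also have "\<rho> r powr (\<gamma> - 1 - 1) = \<rho> r powr (\<gamma> - 1) / \<rho> r"
      using \<rho>(1) [OF r] by (subst powr_diff) simp
    finally show "((\<lambda>r. \<eta> (\<rho> r)) has_real_derivative
      - ((\<gamma> - 1) * \<eta> (\<rho> r) / \<rho> r * (\<rho> r + eos (\<rho> r) / c\<^sup>2) / deriv eos (\<rho> r) * q r)) (at r)"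
      by (rule DERIV_cong) (simp add: \<rho>(2) [OF r] \<eta>_def divide_inverse mult_ac del: minus_add_distrib)
  qed
  have eta_lim: "((\<lambda>r. \<eta> (\<rho> r)) \<longlongrightarrow> 0) (at_left rp)"
  proof -
    have "((\<lambda>r. \<rho> r powr (\<gamma> - 1)) \<longlongrightarrow> 0 powr (\<gamma> - 1)) (at_left rp)"
      using \<rho>_lim tendsto_const
      by (rule tendsto_powr') (use \<gamma> near \<rho>(1) in \<open>auto elim!: eventually_mono intro: less_imp_le\<close>)
    then have "((\<lambda>r. A * \<rho> r powr (\<gamma> - 1) / c\<^sup>2) \<longlongrightarrow> A * 0 / c\<^sup>2) (at_left rp)"
      using c by (intro tendsto_intros) auto
    then show ?thesis by (simp add: \<eta>_def)
  qed
  have \<eta>_pos: "0 < \<eta> s" if "0 < s" for s using that A c by (simp add: \<eta>_def)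
  have "\<forall>\<^sub>F r in at_left rp. r \<in> {0<..<rp} \<and> \<rho> r < s0 \<and> \<eta> (\<rho> r) < r0"
    using near order_tendstoD(2) [OF \<rho>_lim \<open>0 < s0\<close>] order_tendstoD(2) [OF eta_lim r0(1)]
    by eventually_elim simp
  then obtain b where "b < rp" and b: "\<And>r. b < r \<Longrightarrow> r < rp \<Longrightarrow> r \<in> {0<..<rp} \<and> \<rho> r < s0 \<and> \<eta> (\<rho> r) < r0"
    by (auto simp: eventually_at_left_field)
  \<comment> \<open>Halving keeps the closed interval up to \<open>X\<close> away from both r = 0
    and r = b.\<close>
  define X where "X = min (rp - b) rp / 2"
  have X: "0 < X" "X < rp" "\<And>x. x \<in> {0<..X} \<Longrightarrow> rp - x \<in> {0<..<rp} \<and> b < rp - x"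
    using \<open>b < rp\<close> rp by (auto simp: X_def min_def split: if_splits)
  define e where "e x = (if x \<le> 0 then 0 else \<eta> (\<rho> (rp - x)))" for x
  define M where "M x = (if x \<le> 0 then mp else m (rp - x))" for x
  have m_deriv: "\<forall>r\<in>{0<..<rp}. (m has_real_derivative 4 * pi * r\<^sup>2 * \<rho> r) (at r)"
    using sol'(3) by blast
  note e_bd = reflected_boundary [OF eta_lim eta_deriv X(1,2), folded e_def]
  note M_bd = reflected_boundary [OF mp m_deriv X(1,2), folded M_def]

  \<comment> \<open>Constants, and reduction to the boundary problem\<close>
  define kk where "kk = (c\<^sup>2 / A) powr \<nu>"
  have kk: "0 < kk" using A c by (simp add: kk_def)
  \<comment> \<open>This inverts \<eta> = A s^(\<gamma> - 1) / c^2, that is, s = (c^2 \<eta> /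
    A)^\<nu>.\<close>
  have \<rho>_eq: "s = kk * \<eta> s powr \<nu>" if "0 < s" for s
    using that A c \<nu>(2) by (simp add: kk_def \<eta>_def powr_powr flip: powr_mult)
  have P_eq: "eos s / c\<^sup>2 = kk * \<eta> s powr (\<nu> + 1) * \<Omega> (\<eta> s)" if s: "0 < s" for s
  proof -
    have "s powr \<gamma> = s * s powr (\<gamma> - 1)"
      using s by (simp add: powr_diff)
    then have "eos s / c\<^sup>2 = s * \<eta> s * \<Omega> (\<eta> s)"
      unfolding eos [OF s] \<eta>_def by simp
    also have "s * \<eta> s = kk * \<eta> s powr (\<nu> + 1)"
      using \<rho>_eq [OF s] \<eta>_pos [OF s] by (simp add: powr_add)
    finally show ?thesis .
  qed
  have denom_eq: "tov_denom c G \<Lambda> rp x m' = (rp - x)\<^sup>2 * kappa c G \<Lambda> (rp - x) m'" if "x < rp" for x m'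
    using that c by (simp add: tov_denom_def kappa_def field_simps power2_eq_square power4_eq_xxxx)
  have numer_eq: "tov_numer c G \<Lambda> rp x m' (p / c\<^sup>2) = Qfun c G \<Lambda> (rp - x) m' p" for x m' p
    by (simp add: tov_numer_def Qfun_def)
  have denom_0: "tov_denom c G \<Lambda> rp 0 mp = rp\<^sup>2 * kappa_plus c G \<Lambda> rp m"
    using denom_eq [of 0] rp kp by simp
  have numer_0: "tov_numer c G \<Lambda> rp 0 mp 0 = Q_plus c G \<Lambda> rp m P"
    using numer_eq [of 0 mp 0] Qp by simp
  define \<beta> where "\<beta> = K 0 * B"
  have B_pos: "0 < B" using B kQ rp by simp
  have K0_pos: "0 < K 0" using K0 c \<gamma> by simp
  interpret boundary_ivp K \<Omega> Kc Omc r0 c G \<Lambda> rp mp kk \<nu> \<beta>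
  proof
    show "Kc holomorphic_on ball 0 r0" "Omc holomorphic_on ball 0 r0"
      using r0 by (auto intro!: holomorphic_on_subset [OF rK(2)] holomorphic_on_subset [OF rO(2)])
    show "tov_denom c G \<Lambda> rp 0 mp \<noteq> 0" using denom_0 rp kQ by simp
    show "\<beta> = K 0 * tov_numer c G \<Lambda> rp 0 mp 0 / tov_denom c G \<Lambda> rp 0 mp"
      by (simp add: \<beta>_def B denom_0 numer_0)
    show "0 < \<beta>" using B_pos K0_pos by (simp add: \<beta>_def)
  qed (use r0 rK rO c \<nu> kk in auto)
  have e_x: "e x = \<eta> (\<rho> (rp - x))" "M x = m (rp - x)" if "0 < x" for x
    using that by (simp_all add: e_def M_def)
  \<comment> \<open>The right-hand side required by \<open>boundary_expansion\<close> is K(\<eta>) q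
    in the reflected variable.\<close>
  have R: "K (e x) * tov_numer c G \<Lambda> rp x (M x) (kk * e x powr (\<nu> + 1) * \<Omega> (e x)) / tov_denom c G \<Lambda> rp x (M x) =
      K (e x) * q (rp - x)" if x: "x \<in> {0<..X}" for x
  proof -
    have r: "rp - x \<in> {0<..<rp}" using X(3) [OF x] by blast
    show ?thesis
      unfolding q_def using x X(2) P_eq [OF \<rho>(1) [OF r]] \<rho>(2) [OF r]
      by (simp add: e_x denom_eq flip: numer_eq)
  qed
  obtain \<delta> W x1 where W: "0 < \<delta>" "bihol \<delta> W" "W 0 0 = 1"
    and W_in: "\<And>x y. x \<in> ball 0 \<delta> \<Longrightarrow> y \<in> ball 0 \<delta> \<Longrightarrow> 0 < Re (W x y) \<and> of_real \<beta> * x * W x y \<in> ball 0 r0"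
    and x1: "0 < x1" "x1 \<le> X"
    and W_eq: "\<And>x. x \<in> {0..x1} \<Longrightarrow> x < \<delta> \<and> x powr (\<nu> + 1) < \<delta> \<and>
       (\<exists>w>0. W (of_real x) (of_real (x powr (\<nu> + 1))) = of_real w \<and> e x = \<beta> * x * w)"
  proof (rule boundary_expansion [OF X(1) e_bd(2) M_bd(2)])
    show "e 0 = 0" "M 0 = mp" by (simp_all add: e_def M_def)
    show "0 < e x" if "x \<in> {0<..X}" for x
      using X(3) [OF that] that \<rho>(1) \<eta>_pos by (simp add: e_x)
    show "e x < r0" if "x \<in> {0..X}" for x
      using X(3) [of x] that b [of "rp - x"] r0(1) by (cases "x = 0") (auto simp: e_def)
    show "tov_denom c G \<Lambda> rp x (M x) \<noteq> 0" if "x \<in> {0..X}" for x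
    proof (cases "x = 0")
      case True
      then show ?thesis using denom0 by (simp add: M_def)
    next
      case False
      then have "rp - x \<in> {0<..<rp}" using X(3) [of x] that by auto
      then show ?thesis
        using sol'(2) [of "rp - x"] that False by (simp add: e_x denom_eq)
    qed
    show "(e has_real_derivative K (e x) * tov_numer c G \<Lambda> rp x (M x) (kk * e x powr (\<nu> + 1) * \<Omega> (e x)) /
        tov_denom c G \<Lambda> rp x (M x)) (at x)" if x: "x \<in> {0<..<X}" for x
    proof -
      have x': "x \<in> {0<..X}" "x \<in> {0<..<rp}" and r: "rp - x \<in> {0<..<rp}" "b < rp - x" "rp - x < rp"
        using x X(2) X(3) [of x] by auto
      define s where "s = \<rho> (rp - x)"
      have s: "0 < s" "s < s0" using \<rho>(1) [OF r(1)] b [OF r(2,3)] by (auto simp: s_def)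
      have "(\<gamma> - 1) * \<eta> s / s * (s + eos s / c\<^sup>2) / deriv eos s = K (\<eta> s)"
        unfolding K_eq [OF s] using dpos s(1) by (simp add: less_imp_neq [symmetric])
      then show ?thesis
        using e_bd(1) [OF x'(2)] x unfolding R [OF x'(1)] by (simp add: e_x s_def)
    qed
    show "(M has_real_derivative - (4 * pi * (rp - x)\<^sup>2 * (kk * e x powr \<nu>))) (at x)" if x: "x \<in> {0<..<X}" for x
    proof -
      have x': "x \<in> {0<..<rp}" "rp - x \<in> {0<..<rp}" using x X(2) X(3) [of x] by auto
      show ?thesis
        using M_bd(1) [OF x'(1)] \<rho>_eq [OF \<rho>(1) [OF x'(2)]] x by (simp add: e_x)
    qed
  qed (rule that)

  \<comment> \<open>Expansions of u and \<rho>\<close>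
  define f1 where "f1 x y = of_real (K 0) * W x y * Uc (of_real \<beta> * x * W x y)" for x y
  define f2 where "f2 x y = W x y powr of_real \<nu>" for x y
  \<comment> \<open>The factor \<open>f1\<close> comes from u = \<eta> U(\<eta>) with \<eta> =
    \<beta> x W and \<beta> = K(0) B, after division by B x; \<open>f2\<close> comes from \<rho> =
    kk \<eta>^\<nu> after division by kk \<beta>^\<nu> x^\<nu>.\<close>
  have f1: "bihol \<delta> f1"
    unfolding f1_def [abs_def]
    by (intro bihol_mult bihol_const W(2) bihol_compose [OF _ rU(2)] bihol_fst)
       (use W_in r0 in force)
  have f1_0: "f1 0 0 = 1"
    using rU(3) [of 0] rU(1) K0_pos by (simp add: f1_def W(3) U0)
  have f2: "bihol \<delta> f2"
    unfolding f2_def [abs_def]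
  \<comment> \<open>A positive real part of \<open>W\<close> keeps its values off the branch cut of
    the power.\<close>
  proof (rule bihol_compose [OF W(2), where T = "{z. 0 < Re z}"])
    show "(\<lambda>z. z powr of_real \<nu>) holomorphic_on {z. 0 < Re z}"
      by (intro holomorphic_intros) (auto simp: complex_nonpos_Reals_iff)
  qed (use W_in in auto)
  have f2_0: "f2 0 0 = 1" by (simp add: f2_def W(3))
  obtain a ea where a: "dps_convergent a" "0 < ea"
    "\<And>x y. \<bar>x\<bar> < ea \<Longrightarrow> \<bar>y\<bar> < ea \<Longrightarrow> Re (f1 (of_real x) (of_real y)) = 1 + dps_eval a x y"
    by (rule bihol_dps [OF f1 W(1) f1_0], rule that)
  obtain a' eb where a': "dps_convergent a'" "0 < eb"
    "\<And>x y. \<bar>x\<bar> < eb \<Longrightarrow> \<bar>y\<bar> < eb \<Longrightarrow> Re (f2 (of_real x) (of_real y)) = 1 + dps_eval a' x y"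
    by (rule bihol_dps [OF f2 W(1) f2_0], rule that)
  \<comment> \<open>The c^2 in \<open>kk\<close> cancels against the one in K(0) = (\<gamma> - 1) /
    (c^2 \<gamma>), which produces the constant of the theorem.\<close>
  have const: "kk * \<beta> powr \<nu> = ((\<gamma> - 1) * B / (\<gamma> * A)) powr \<nu>"
    using A c \<gamma> B_pos by (simp add: kk_def \<beta>_def K0 mult.commute [of A] flip: powr_mult)
  have "((\<lambda>r. rp - r) \<longlongrightarrow> 0) (at_left rp)" "((\<lambda>r. (rp - r) powr (\<nu> + 1)) \<longlongrightarrow> 0) (at_left rp)"
    using \<nu>(1) by real_asymp+
  then have "\<forall>\<^sub>F r in at_left rp. rp - r < min ea eb \<and> (rp - r) powr (\<nu> + 1) < min ea eb"
    using a(2) a'(2) by (intro eventually_conj order_tendstoD(2)) auto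
  moreover have "\<forall>\<^sub>F r in at_left rp. r \<in> {rp - x1<..<rp}"
    using x1 by (intro eventually_at_left_real) auto
  ultimately have main: "\<forall>\<^sub>F r in at_left rp.
      u r = B * (rp - r) * (1 + dps_eval a (rp - r) ((rp - r) powr (\<nu> + 1))) \<and>
      \<rho> r = ((\<gamma> - 1) * B / (\<gamma> * A)) powr \<nu> * (rp - r) powr \<nu> *
        (1 + dps_eval a' (rp - r) ((rp - r) powr (\<nu> + 1)))"
  proof eventually_elim
    case (elim r)
    define x where "x = rp - r"
    define y where "y = x powr (\<nu> + 1)"
    have x: "x \<in> {0..x1}" "0 < x" "x \<in> {0<..X}" and r: "r = rp - x" using elim x1 by (auto simp: x_def)
    have rr: "r \<in> {0<..<rp}" and br: "b < r" "r < rp" using X(3) [OF x(3)] by (auto simp: r)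
    have xy: "\<bar>x\<bar> < ea" "\<bar>y\<bar> < ea" "\<bar>x\<bar> < eb" "\<bar>y\<bar> < eb"
      using elim x by (auto simp: x_def y_def)
    obtain w where w: "0 < w" "W (of_real x) (of_real y) = of_real w" "e x = \<beta> * x * w"
      using W_eq [OF x(1)] by (auto simp: y_def)
    have e_eta: "\<eta> (\<rho> r) = \<beta> * x * w" using w(3) x(2) by (simp add: e_x r)
    have s: "0 < \<rho> r" "\<rho> r < s0" "\<eta> (\<rho> r) < r0" using \<rho>(1) [OF rr] b [OF br] by auto
    have "Uc (of_real \<beta> * of_real x * of_real w) = of_real (U (\<beta> * x * w))"
      using rU(3) [of "\<beta> * x * w"] s(3) \<eta>_pos [OF s(1)] r0(3) unfolding e_eta by simp
    then have "1 + dps_eval a x y = K 0 * w * U (\<beta> * x * w)"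
      unfolding a(3) [OF xy(1,2), symmetric] f1_def w(2) by simp
    moreover have "u r = \<beta> * x * w * U (\<beta> * x * w)"
      using u_def [OF rr] U_eq [OF s(1,2)] e_eta by simp
    ultimately have 1: "u r = B * x * (1 + dps_eval a x y)"
      by (simp add: \<beta>_def)
    have "1 + dps_eval a' x y = w powr \<nu>"
      unfolding a'(3) [OF xy(3,4), symmetric] f2_def w(2) using w(1) by (simp add: powr_of_real)
    moreover have "\<rho> r = kk * (\<beta> powr \<nu> * x powr \<nu> * w powr \<nu>)"
      using \<rho>_eq [OF s(1)] e_eta w(1) x(2) pos by (simp add: powr_mult)
    ultimately have 2: "\<rho> r = ((\<gamma> - 1) * B / (\<gamma> * A)) powr \<nu> * x powr \<nu> * (1 + dps_eval a' x y)"
      unfolding const [symmetric] by simp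
    show ?case using 1 2 by (simp add: x_def y_def)
  qed
  show ?thesis
    unfolding \<nu>(3) \<nu>_def [symmetric]
    using a(1) a'(1) main
    by (intro conjI exI [of _ a] exI [of _ a']) (auto elim: eventually_mono)
qed

end
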